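(* Let $\mathfrak{g}$ be a finite dimensional simple Lie algebra over $\mathbb{C}$, let $\lambda,\mu\in P^+$ be dominant integral weights, and let $k\geq 1$ be an integer (the level). Then $$\langle\lambda+\mu,\theta\rangle\leq k \quad\text{if and only if}\quad \Pi^\lambda+\mu+\rho\subseteq\mathcal{F}_k'.$$
   Context: Let $\mathfrak{g}$ be a finite dimensional simple complex Lie algebra of rank $\ell$ with Cartan subalgebra $H$, simple roots $\alpha_1,\dots,\alpha_\ell$, highest root $\theta$, and Weyl group $W$ acting on $H^*$. The symmetric bilinear form $(\cdot,\cdot)$ on $H^*$ is the $W$-invariant one normalized by $(\theta,\theta)=2$. For a root $\alpha$ put $\langle\lambda,\alpha\rangle = 2(\lambda,\alpha)/(\alpha,\alpha)$; in particular $\langle\lambda,w\theta\rangle=(\lambda,w\theta)$ for $w\in W$. The fundamental weights $\lambda_1,\dots,\lambda_\ell$ satisfy $\langle\lambda_i,\alpha_j\rangle=\delta_{ij}$; $P$ is their $\mathbb{Z}$-span (the weight lattice), $P^+$ is the set of their nonnegative integer combinations (dominant integral weights), and $\rho=\sum_{i=1}^{\ell}\lambda_i$. The dual Coxeter number is $\check h = 1+\langle\rho,\theta\rangle$. For an integer $k\geq 1$, $$\mathcal{F}_k'=\{\mu\in P \mid -(k+\check h)<\langle\mu,w\theta\rangle<k+\check h \text{ for all } w\in W\}.$$ For $\lambda\in P^+$, $V^\lambda$ is the finite dimensional irreducible $\mathfrak{g}$-module with highest weight $\lambda$, $V^\lambda_\beta$ is its $\beta$ weight space, and $\Pi^\lambda=\{\beta\in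 H^*\mid V^\lambda_\beta\neq 0\}$ is its set of weights. The set $\Pi^\lambda+\mu+\rho$ is $\{\beta+\mu+\rho\mid\beta\in\Pi^\lambda\}$. *)

theory Defs
  imports Complex_Main "HOL-Library.Function_Algebras" "HOL-Library.Complex_Order"
begin

text \<open>
  Addition, negation and zero of functionals are the pointwise operations of
  Function_Algebras.  The order on complex numbers is that of Complex_Order:
  \<open>z \<le> w\<close> holds iff the real parts are so ordered and the imaginary parts agree.
\<close>

definition fscale :: "complex \<Rightarrow> ('a \<Rightarrow> complex) \<Rightarrow> 'a \<Rightarrow> complex" where
  "fscale c f = (\<lambda>x. c * f x)"

definition pairing ::
    "(('a \<Rightarrow> complex) \<Rightarrow> ('a \<Rightarrow> complex) \<Rightarrow> complex)
      \<Rightarrow> ('a \<Rightarrow> complex) \<Rightarrow> ('a \<Rightarrow> complex) \<Rightarrow> complex" where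
  "pairing form f a = 2 * form f a / form a a"

locale lie_algebra = vector_space scale
  for scale :: "complex \<Rightarrow> 'g::ab_group_add \<Rightarrow> 'g" +
  fixes bracket :: "'g \<Rightarrow> 'g \<Rightarrow> 'g"
  assumes bracket_add_left: "bracket (x + y) z = bracket x z + bracket y z"
    and bracket_add_right: "bracket x (y + z) = bracket x y + bracket x z"
    and bracket_scale_left: "bracket (scale c x) y = scale c (bracket x y)"
    and bracket_scale_right: "bracket x (scale c y) = scale c (bracket x y)"
    and bracket_self: "bracket x x = 0"
    and jacobi: "bracket x (bracket y z) + bracket y (bracket z x) + bracket z (bracket x y) = 0"
begin

definition ideal :: "'g set \<Rightarrow> bool" where
  "ideal I \<longleftrightarrow> subspace I \<and> (\<forall>x. \<forall>y\<in>I. bracket x y \<in> I)"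

text \<open>
  The textbook definition for semisimple complex Lie algebras: a maximal abelian
  subalgebra all of whose elements are ad-diagonalizable.
\<close>
definition cartan_subalgebra :: "'g set \<Rightarrow> bool" where
  "cartan_subalgebra H \<longleftrightarrow> subspace H
     \<and> (\<forall>x\<in>H. \<forall>y\<in>H. bracket x y = 0)
     \<and> (\<forall>x. (\<forall>h\<in>H. bracket h x = 0) \<longrightarrow> x \<in> H)
     \<and> (\<forall>h\<in>H. span {x. \<exists>c. bracket h x = scale c x} = UNIV)"

end

locale simple_lie_algebra = lie_algebra +
  assumes finite_dim: "\<exists>B. finite B \<and> span B = UNIV"
    and nonabelian: "\<exists>x y. bracket x y \<noteq> 0"
    and ideal_trivial: "ideal I \<Longrightarrow> I = {0} \<or> I = UNIV"

locale simple_lie_algebra_cartan = simple_lie_algebra +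
  fixes H :: "'a set"
  assumes cartan: "cartan_subalgebra H"
begin

text \<open>
  The dual space \<open>H*\<close>: linear functionals on \<open>H\<close>, extended by zero outside \<open>H\<close>
  so that equality of functionals is equality on \<open>H\<close>.
\<close>
definition dual :: "('a \<Rightarrow> complex) set" where
  "dual = {f. (\<forall>x\<in>H. \<forall>y\<in>H. f (x + y) = f x + f y)
            \<and> (\<forall>c. \<forall>x\<in>H. f (scale c x) = c * f x)
            \<and> (\<forall>x. x \<notin> H \<longrightarrow> f x = 0)}"

definition rank :: nat where
  "rank = dim H"

definition root_space :: "('a \<Rightarrow> complex) \<Rightarrow> 'a set" where
  "root_space a = {x. \<forall>h\<in>H. bracket h x = scale (a h) x}"

definition roots :: "('a \<Rightarrow> complex) set" where
  "roots = {a \<in> dual. a \<noteq> 0 \<and> root_space a \<noteq> {0}}"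

text \<open>The unique element of \<open>[g_a, g_{-a}]\<close> on which the root \<open>a\<close> takes the value 2.\<close>
definition coroot :: "('a \<Rightarrow> complex) \<Rightarrow> 'a" where
  "coroot a = (THE h. h \<in> span {bracket x y | x y. x \<in> root_space a \<and> y \<in> root_space (- a)}
                      \<and> a h = 2)"

definition reflection :: "('a \<Rightarrow> complex) \<Rightarrow> ('a \<Rightarrow> complex) \<Rightarrow> ('a \<Rightarrow> complex)" where
  "reflection a f = f - fscale (f (coroot a)) a"

text \<open>Reflections are involutions, so closing under composition already gives the group.\<close>
inductive_set weyl_group :: "(('a \<Rightarrow> complex) \<Rightarrow> ('a \<Rightarrow> complex)) set" where
  one: "id \<in> weyl_group"
| refl: "a \<in> roots \<Longrightarrow> w \<in> weyl_group \<Longrightarrow> reflection a \<circ> w \<in> weyl_group"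

definition nonneg_comb :: "(nat \<Rightarrow> 'a \<Rightarrow> complex) \<Rightarrow> ('a \<Rightarrow> complex) \<Rightarrow> bool" where
  "nonneg_comb v f \<longleftrightarrow> (\<exists>n :: nat \<Rightarrow> nat. f = (\<Sum>i=1..rank. fscale (of_nat (n i)) (v i)))"

text \<open>A base of the root system: since there are \<open>rank\<close> many, the independent family
  \<open>\<alpha> 1, \<dots>, \<alpha> rank\<close> is a basis of \<open>H*\<close>.\<close>
definition simple_roots :: "(nat \<Rightarrow> 'a \<Rightarrow> complex) \<Rightarrow> bool" where
  "simple_roots \<alpha> \<longleftrightarrow> (\<forall>i\<in>{1..rank}. \<alpha> i \<in> roots)
     \<and> (\<forall>c :: nat \<Rightarrow> complex.
          (\<Sum>i=1..rank. fscale (c i) (\<alpha> i)) = 0 \<longrightarrow> (\<forall>i\<in>{1..rank}. c i = 0))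
     \<and> (\<forall>b\<in>roots. nonneg_comb \<alpha> b \<or> nonneg_comb \<alpha> (- b))"

definition positive_roots :: "(nat \<Rightarrow> 'a \<Rightarrow> complex) \<Rightarrow> ('a \<Rightarrow> complex) set" where
  "positive_roots \<alpha> = {b \<in> roots. nonneg_comb \<alpha> b}"

definition highest_root :: "(nat \<Rightarrow> 'a \<Rightarrow> complex) \<Rightarrow> ('a \<Rightarrow> complex) \<Rightarrow> bool" where
  "highest_root \<alpha> \<theta> \<longleftrightarrow> \<theta> \<in> roots \<and> (\<forall>b\<in>roots. nonneg_comb \<alpha> (\<theta> - b))"

definition invariant_form :: "(('a \<Rightarrow> complex) \<Rightarrow> ('a \<Rightarrow> complex) \<Rightarrow> complex) \<Rightarrow> bool" where
  "invariant_form form \<longleftrightarrow>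
       (\<forall>f\<in>dual. \<forall>g\<in>dual. form f g = form g f)
     \<and> (\<forall>f\<in>dual. \<forall>g\<in>dual. \<forall>h\<in>dual. form (f + g) h = form f h + form g h)
     \<and> (\<forall>c. \<forall>f\<in>dual. \<forall>g\<in>dual. form (fscale c f) g = c * form f g)
     \<and> (\<forall>w\<in>weyl_group. \<forall>f\<in>dual. \<forall>g\<in>dual. form (w f) (w g) = form f g)"

end

text \<open>
  The invariant form normalized by \<open>(\<theta>, \<theta>) = 2\<close> and the fundamental weights exist
  and are unique (the latter on the indices \<open>1, \<dots>, rank\<close>); they are named here by the
  properties that determine them.
\<close>
locale simple_lie_algebra_data = simple_lie_algebra_cartan +
  fixes \<alpha> :: "nat \<Rightarrow> 'a \<Rightarrow> complex"
    and \<theta> :: "'a \<Rightarrow> complex"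
    and form :: "('a \<Rightarrow> complex) \<Rightarrow> ('a \<Rightarrow> complex) \<Rightarrow> complex"
    and fund :: "nat \<Rightarrow> 'a \<Rightarrow> complex"
  assumes simple_roots: "simple_roots \<alpha>"
    and highest_root: "highest_root \<alpha> \<theta>"
    and invariant_form: "invariant_form form"
    and normalized: "form \<theta> \<theta> = 2"
    and fund_dual: "i \<in> {1..rank} \<Longrightarrow> fund i \<in> dual"
    and fund_simple: "i \<in> {1..rank} \<Longrightarrow> j \<in> {1..rank} \<Longrightarrow>
          pairing form (fund i) (\<alpha> j) = (if i = j then 1 else 0)"
begin

definition weight_lattice :: "('a \<Rightarrow> complex) set" where
  "weight_lattice = {f. \<exists>n :: nat \<Rightarrow> int. f = (\<Sum>i=1..rank. fscale (of_int (n i)) (fund i))}"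

definition dominant_weights :: "('a \<Rightarrow> complex) set" where
  "dominant_weights = {f. nonneg_comb fund f}"

definition rho :: "'a \<Rightarrow> complex" where
  "rho = (\<Sum>i=1..rank. fund i)"

definition dual_coxeter :: complex where
  "dual_coxeter = 1 + pairing form rho \<theta>"

definition level_set :: "int \<Rightarrow> ('a \<Rightarrow> complex) set" where
  "level_set k = {f \<in> weight_lattice. \<forall>w\<in>weyl_group.
      - (of_int k + dual_coxeter) < pairing form f (w \<theta>) \<and> pairing form f (w \<theta>) < of_int k + dual_coxeter}"

end

locale lie_module =
  lie_algebra scale bracket + V: vector_space scaleV
  for scale :: "complex \<Rightarrow> 'g::ab_group_add \<Rightarrow> 'g"
    and bracket :: "'g \<Rightarrow> 'g \<Rightarrow> 'g"
    and scaleV :: "complex \<Rightarrow> 'v::ab_group_add \<Rightarrow> 'v" +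
  fixes act :: "'g \<Rightarrow> 'v \<Rightarrow> 'v"
  assumes act_add_left: "act (x + y) v = act x v + act y v"
    and act_add_right: "act x (v + u) = act x v + act x u"
    and act_scale_left: "act (scale c x) v = scaleV c (act x v)"
    and act_scale_right: "act x (scaleV c v) = scaleV c (act x v)"
    and act_bracket: "act (bracket x y) v = act x (act y v) - act y (act x v)"
begin

definition finite_dim_irreducible :: bool where
  "finite_dim_irreducible \<longleftrightarrow>
       (\<exists>B. finite B \<and> V.span B = UNIV)
     \<and> (\<exists>v :: 'v. v \<noteq> 0)
     \<and> (\<forall>U. V.subspace U \<and> (\<forall>x. \<forall>v\<in>U. act x v \<in> U) \<longrightarrow> U = {0} \<or> U = UNIV)"

end

locale simple_lie_algebra_module =
  simple_lie_algebra_data scale bracket H \<alpha> \<theta> form fund + lie_module scale bracket scaleV act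
  for scale :: "complex \<Rightarrow> 'g::ab_group_add \<Rightarrow> 'g"
    and bracket :: "'g \<Rightarrow> 'g \<Rightarrow> 'g"
    and H :: "'g set"
    and \<alpha> :: "nat \<Rightarrow> 'g \<Rightarrow> complex"
    and \<theta> :: "'g \<Rightarrow> complex"
    and form :: "('g \<Rightarrow> complex) \<Rightarrow> ('g \<Rightarrow> complex) \<Rightarrow> complex"
    and fund :: "nat \<Rightarrow> 'g \<Rightarrow> complex"
    and scaleV :: "complex \<Rightarrow> 'v::ab_group_add \<Rightarrow> 'v"
    and act :: "'g \<Rightarrow> 'v \<Rightarrow> 'v"
begin

definition weight_space :: "('g \<Rightarrow> complex) \<Rightarrow> 'v set" where
  "weight_space b = {v. \<forall>h\<in>H. act h v = scaleV (b h) v}"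

definition weights :: "('g \<Rightarrow> complex) set" where
  "weights = {b \<in> dual. weight_space b \<noteq> {0}}"

text \<open>There is a nonzero vector of weight \<open>l\<close> annihilated by all positive root spaces.\<close>
definition has_highest_weight :: "('g \<Rightarrow> complex) \<Rightarrow> bool" where
  "has_highest_weight l \<longleftrightarrow> l \<in> dual \<and>
     (\<exists>v\<in>weight_space l. v \<noteq> 0 \<and> (\<forall>a\<in>positive_roots \<alpha>. \<forall>x\<in>root_space a. act x v = 0))"

end

end

theory Submission
  imports Defs
begin

text \<open>
  For a weight \<open>b\<close> of \<open>V\<close> and \<open>w\<close> in the Weyl group, invariance gives \<open>(b, w \<theta>) = (w\<inverse> b, \<theta>)\<close>, which
  lies between \<open>\<plusminus> (l, \<theta>)\<close> since the weights are Weyl invariant, lie below \<open>l\<close>, and \<open>\<theta>\<close> is dominant.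
  As \<open>\<plusminus> w \<theta>\<close> are roots, hence below \<open>\<theta>\<close>, also \<open>\<bar>(m + \<rho>, w \<theta>)\<bar> \<le> (m + \<rho>, \<theta>)\<close>.  So the extreme value is
  \<open>(l + m + \<rho>, \<theta>)\<close>, attained at \<open>b = l\<close> and \<open>w = 1\<close>, and by integrality it is less than
  \<open>k + 1 + (\<rho>, \<theta>)\<close> iff \<open>(l + m, \<theta>) \<le> k\<close>.

  The structure theory is elementary.  A sum \<open>h\<close> of brackets \<open>[x, y]\<close> with \<open>x\<close> of weight \<open>a\<close> and \<open>y\<close> of
  weight \<open>- a\<close> has trace zero on every \<open>a\<close>-string, so each root is a real multiple of \<open>a\<close> at \<open>h\<close>.
  This makes the coroot unique and, as some such \<open>h\<close> is nonzero, the Killing form nonzero,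
  hence nondegenerate by simplicity; so every root lies in an \<open>sl\<^sub>2\<close>-triple.
\<close>

subsection \<open>Traces and diagonalizable operators\<close>

text \<open>The invariant form is complex-valued and given only by symmetry, bilinearity, Weyl
  invariance and \<open>form \<theta> \<theta> = 2\<close>. The comparisons
  \<open>(m, b) \<le> (m, \<theta>)\<close> for roots \<open>b\<close> need every
  \<open>(\<alpha> j, \<alpha> j)\<close> to be a positive real, so positivity has to be carried
  from \<open>\<theta>\<close> to all simple roots. Since \<open>\<theta>\<close> lies above every
  root, all its simple coefficients are at least 1, and this guarantees that no simple root is
  missed.

  The integrality of \<open>(fund j, \<theta>)\<close> says that \<open>coroot \<theta>\<close> is
  an integral combination of simple coroots. To prove it, roots of square length 2 are lowered by
  simple reflections until a multiple of a simple root is left; excluding the multiple 2 is the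
  purpose of showing that twice a root is not a root.

  An inequality between complex numbers also asserts equal imaginary parts, so the bounds are
  ultimately obtained from sums of nonnegative products and from integers.\<close>

text \<open>
  For a finite independent \<open>S\<close> and \<open>f\<close> preserving \<open>span S\<close>, the trace of \<open>f\<close> on \<open>span S\<close>;
  \<open>representation\<close> returns zero coefficients for vectors outside \<open>span S\<close>.
\<close>
definition trace_on ::
    "('a::field \<Rightarrow> 'b::ab_group_add \<Rightarrow> 'b) \<Rightarrow> 'b set \<Rightarrow> ('b \<Rightarrow> 'b) \<Rightarrow> 'a" where
  "trace_on scale S f = (\<Sum>b\<in>S. module.representation scale S (f b) b)"

context vector_space
begin

text \<open>Both traces expand to the same double sum of matrix entries. Only the images of
  \<open>S\<close> have to lie in \<open>span S\<close>, so operators on the whole space can be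
  traced on a stable part without restricting them.\<close>

lemma trace_on_commute:
  assumes fin: "finite S" and ind: "independent S"
    and f: "Vector_Spaces.linear scale scale f" "f ` S \<subseteq> span S"
    and g: "Vector_Spaces.linear scale scale g" "g ` S \<subseteq> span S"
  shows "trace_on scale S (\<lambda>b. f (g b)) = trace_on scale S (\<lambda>b. g (f b))"
proof -
  have expand: "representation S (p (q b)) b
      = (\<Sum>c\<in>S. representation S (q b) c * representation S (p c) b)"
    if p: "Vector_Spaces.linear scale scale p" "p ` S \<subseteq> span S" and q: "q ` S \<subseteq> span S"
      and b: "b \<in> S" for p q b
  proof -
    interpret p: Vector_Spaces.linear scale scale p by fact
    have "q b = (\<Sum>c\<in>S. scale (representation S (q b) c) c)"
      using sum_representation_eq[OF ind _ fin order_refl, of "q b"] q b by auto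
    then have "p (q b) = p (\<Sum>c\<in>S. scale (representation S (q b) c) c)"
      by simp
    also have "\<dots> = (\<Sum>c\<in>S. scale (representation S (q b) c) (p c))"
      by (simp add: p.sum p.scale)
    finally have "representation S (p (q b))
        = representation S (\<Sum>c\<in>S. scale (representation S (q b) c) (p c))"
      by simp
    also have "\<dots> = (\<lambda>x. \<Sum>c\<in>S. representation S (scale (representation S (q b) c) (p c)) x)"
      using p(2) by (intro representation_sum[OF ind]) (auto intro: span_scale)
    finally show ?thesis
      using p(2) by (auto simp: representation_scale[OF ind] intro!: sum.cong)
  qed
  have "trace_on scale S (\<lambda>b. f (g b))
      = (\<Sum>b\<in>S. \<Sum>c\<in>S. representation S (g b) c * representation S (f c) b)"
    unfolding trace_on_def using expand[OF f g(2)] by (rule sum.cong[OF refl])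
  also have "\<dots> = (\<Sum>c\<in>S. \<Sum>b\<in>S. representation S (f c) b * representation S (g b) c)"
    by (subst sum.swap) (simp add: mult.commute)
  also have "\<dots> = trace_on scale S (\<lambda>b. g (f b))"
    unfolding trace_on_def using expand[OF g f(2)] by (intro sum.cong[OF refl]) auto
  finally show ?thesis .
qed

lemma trace_on_add:
  assumes "independent S" "f ` S \<subseteq> span S" "g ` S \<subseteq> span S"
  shows "trace_on scale S (\<lambda>b. f b + g b) = trace_on scale S f + trace_on scale S g"
  unfolding trace_on_def sum.distrib[symmetric]
  using assms by (intro sum.cong[OF refl]) (auto simp: representation_add image_subset_iff)

lemma trace_on_diff:
  assumes "independent S" "f ` S \<subseteq> span S" "g ` S \<subseteq> span S"
  shows "trace_on scale S (\<lambda>b. f b - g b) = trace_on scale S f - trace_on scale S g"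
  unfolding trace_on_def sum_subtractf[symmetric]
  using assms by (intro sum.cong[OF refl]) (auto simp: representation_diff image_subset_iff)

lemma trace_on_scale:
  assumes "independent S" "f ` S \<subseteq> span S"
  shows "trace_on scale S (\<lambda>b. scale c (f b)) = c * trace_on scale S f"
  unfolding trace_on_def sum_distrib_left
  using assms by (intro sum.cong[OF refl]) (auto simp: representation_scale image_subset_iff)

lemma trace_on_diagonal:
  assumes "independent S" "\<And>b. b \<in> S \<Longrightarrow> f b = scale (c b) b"
  shows "trace_on scale S f = (\<Sum>b\<in>S. c b)"
  unfolding trace_on_def
  using assms by (intro sum.cong[OF refl])
    (auto simp: representation_scale representation_basis span_base)

text \<open>Applying \<open>A - d\<close> to the sum removes \<open>u d\<close>, multiplies every
  other \<open>u c\<close> by the nonzero scalar \<open>c - d\<close> and does not leave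
  \<open>W\<close>; the induction hypothesis yields the other summands and subtraction yields
  \<open>u d\<close>.\<close>

lemma eigenvector_summand_mem:
  assumes "finite C" and A: "Vector_Spaces.linear scale scale A"
    and W: "subspace W" "A ` W \<subseteq> W"
    and "\<And>c. c \<in> C \<Longrightarrow> A (u c) = scale c (u c)" "(\<Sum>c\<in>C. u c) \<in> W" "c \<in> C"
  shows "u c \<in> W"
  using assms(1) assms(5-)
proof (induction C arbitrary: u c rule: finite_induct)
  case (insert d C)
  interpret A: Vector_Spaces.linear scale scale A by fact
  let ?s = "\<Sum>c\<in>insert d C. u c"
  have A_s: "A ?s = (\<Sum>c\<in>insert d C. scale c (u c))"
    using insert.prems(1) by (simp only: A.sum cong: sum.cong)
  have "A ?s - scale d ?s = (\<Sum>c\<in>insert d C. scale (c - d) (u c))"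
    unfolding A_s scale_sum_right sum_subtractf[symmetric] scale_left_diff_distrib ..
  also have "\<dots> = (\<Sum>c\<in>C. scale (c - d) (u c))"
    using insert.hyps by simp
  finally have "A ?s - scale d ?s = (\<Sum>c\<in>C. scale (c - d) (u c))" .
  moreover have "A ?s - scale d ?s \<in> W"
    using insert.prems(2) W by (blast intro: subspace_diff subspace_scale)
  ultimately have mem: "(\<Sum>c\<in>C. scale (c - d) (u c)) \<in> W"
    by simp
  have C: "u c \<in> W" if c: "c \<in> C" for c
  proof -
    have "scale (c - d) (u c) \<in> W"
      using mem insert.prems(1) c
      by (intro insert.IH[of "\<lambda>c. scale (c - d) (u c)"])
        (simp_all add: A.scale mult.commute)
    then have "scale (inverse (c - d)) (scale (c - d) (u c)) \<in> W"
      using W(1) by (blast intro: subspace_scale)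
    moreover have "c \<noteq> d"
      using c insert.hyps by auto
    ultimately show ?thesis
      by simp
  qed
  have "u d = ?s - (\<Sum>c\<in>C. u c)"
    using insert.hyps by simp
  also have "\<dots> \<in> W"
    using insert.prems(2) C W(1) by (blast intro: subspace_diff subspace_sum)
  finally show ?case
    using C insert.prems(3) by blast
qed auto

text \<open>Collecting an expansion of \<open>w\<close> by eigenvalue gives summands that lie in
  \<open>W\<close> by the previous lemma. This makes it possible to diagonalize \<open>H\<close>
  simultaneously, one element at a time.\<close>

lemma diagonalizable_on_stable_subspace:
  assumes A: "Vector_Spaces.linear scale scale A"
    and diag: "span {x. \<exists>c. A x = scale c x} = UNIV"
    and W: "subspace W" "A ` W \<subseteq> W" and w: "w \<in> W"
  shows "w \<in> span {x \<in> W. \<exists>c. A x = scale c x}"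
proof -
  interpret A: Vector_Spaces.linear scale scale A by fact
  have "w \<in> span {x. \<exists>c. A x = scale c x}"
    using diag by simp
  then obtain T r where T: "finite T" "T \<subseteq> {x. \<exists>c. A x = scale c x}"
    and wT: "w = (\<Sum>t\<in>T. scale (r t) t)"
    by (auto simp: span_explicit)
  then obtain ev where ev: "\<And>t. t \<in> T \<Longrightarrow> A t = scale (ev t) t"
    using bchoice[of T "\<lambda>t c. A t = scale c t"] by blast
  define u where "u c = (\<Sum>t\<in>{t \<in> T. ev t = c}. scale (r t) t)" for c
  have w_sum: "w = (\<Sum>c\<in>ev ` T. u c)"
    unfolding u_def wT using T(1) by (rule sum.image_gen)
  have eig: "A (u c) = scale c (u c)" for c
    unfolding u_def using ev
    by (auto simp: A.sum A.scale scale_sum_right intro!: sum.cong)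
  have "u c \<in> {x \<in> W. \<exists>c. A x = scale c x}" if "c \<in> ev ` T" for c
    using eigenvector_summand_mem[OF _ A W eig _ that] T(1) w_sum w eig by auto
  then show ?thesis
    unfolding w_sum by (intro span_sum span_base)
qed

end

subsection \<open>Weight spaces\<close>

lemma fscale_apply [simp]: "fscale c f x = c * f x"
  by (simp add: fscale_def)

section \<open>Functionals on the Cartan subalgebra\<close>

context simple_lie_algebra_cartan
begin

lemma subspace_H: "subspace H"
  and H_commute: "\<lbrakk>x \<in> H; y \<in> H\<rbrakk> \<Longrightarrow> bracket x y = 0"
  and H_self_centralizing: "(\<And>h. h \<in> H \<Longrightarrow> bracket h x = 0) \<Longrightarrow> x \<in> H"
  and H_diagonalizable: "h \<in> H \<Longrightarrow> span {x. \<exists>c. bracket h x = scale c x} = UNIV"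
  using cartan unfolding cartan_subalgebra_def by blast+

lemma dual_0: "0 \<in> dual"
  and dual_add: "\<lbrakk>f \<in> dual; g \<in> dual\<rbrakk> \<Longrightarrow> f + g \<in> dual"
  and dual_diff: "\<lbrakk>f \<in> dual; g \<in> dual\<rbrakk> \<Longrightarrow> f - g \<in> dual"
  and dual_minus: "f \<in> dual \<Longrightarrow> - f \<in> dual"
  and dual_fscale: "f \<in> dual \<Longrightarrow> fscale c f \<in> dual"
  by (auto simp: dual_def algebra_simps)

lemma dual_sum: "(\<And>i. i \<in> I \<Longrightarrow> f i \<in> dual) \<Longrightarrow> (\<Sum>i\<in>I. f i) \<in> dual"
  by (induction I rule: infinite_finite_induct) (auto intro: dual_0 dual_add)

lemmas dual_closed = dual_0 dual_add dual_diff dual_minus dual_fscale dual_sum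

lemma dual_apply_add: "\<lbrakk>f \<in> dual; x \<in> H; y \<in> H\<rbrakk> \<Longrightarrow> f (x + y) = f x + f y"
  and dual_apply_scale: "\<lbrakk>f \<in> dual; x \<in> H\<rbrakk> \<Longrightarrow> f (scale c x) = c * f x"
  by (auto simp: dual_def)

lemma dual_apply_0: "f \<in> dual \<Longrightarrow> f 0 = 0"
  using dual_apply_scale[of f 0 0] subspace_0[OF subspace_H] by simp

lemma dual_eqI: "\<lbrakk>f \<in> dual; g \<in> dual; \<And>h. h \<in> H \<Longrightarrow> f h = g h\<rbrakk> \<Longrightarrow> f = g"
proof (rule ext)
  fix x
  assume "f \<in> dual" "g \<in> dual" "\<And>h. h \<in> H \<Longrightarrow> f h = g h"
  then show "f x = g x"
    by (cases "x \<in> H") (auto simp: dual_def)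
qed

lemma roots_dual: "a \<in> roots \<Longrightarrow> a \<in> dual"
  and roots_nonzero: "a \<in> roots \<Longrightarrow> a \<noteq> 0"
  by (auto simp: roots_def)

end

text \<open>Facts about weights that involve only the Cartan subalgebra and its roots are proved
  here once, and then applied both to \<open>V\<close> and to the adjoint representation
  \<open>ad\<close>, whose nonzero weights are the roots.\<close>

locale cartan_module =
  simple_lie_algebra_cartan scale bracket H + lie_module scale bracket scaleV act
  for scale :: "complex \<Rightarrow> 'g::ab_group_add \<Rightarrow> 'g"
    and bracket :: "'g \<Rightarrow> 'g \<Rightarrow> 'g"
    and H :: "'g set"
    and scaleV :: "complex \<Rightarrow> 'v::ab_group_add \<Rightarrow> 'v"
    and act :: "'g \<Rightarrow> 'v \<Rightarrow> 'v"
begin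

sublocale act: Vector_Spaces.linear scaleV scaleV "act x" for x
  by (simp add: Vector_Spaces.linear_iff V.vector_space_axioms act_add_right act_scale_right)

sublocale act_left: Vector_Spaces.linear scale scaleV "\<lambda>x. act x v" for v
  by (simp add: Vector_Spaces.linear_iff vector_space_axioms V.vector_space_axioms act_add_left act_scale_left)

definition wspace :: "('g \<Rightarrow> complex) \<Rightarrow> 'v set" where
  "wspace b = {v. \<forall>h\<in>H. act h v = scaleV (b h) v}"

definition wts :: "('g \<Rightarrow> complex) set" where
  "wts = {b \<in> dual. wspace b \<noteq> {0}}"

lemma subspace_wspace: "V.subspace (wspace b)"
  by (auto simp: V.subspace_def wspace_def act.add act.scale V.scale_right_distrib
      mult.commute)

lemma act_wspace: "\<lbrakk>v \<in> wspace b; h \<in> H\<rbrakk> \<Longrightarrow> act h v = scaleV (b h) v"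
  by (simp add: wspace_def)

lemma wtsI: "\<lbrakk>b \<in> dual; v \<in> wspace b; v \<noteq> 0\<rbrakk> \<Longrightarrow> b \<in> wts"
  by (auto simp: wts_def)

lemma wtsE:
  assumes "b \<in> wts"
  obtains v where "v \<in> wspace b" "v \<noteq> 0"
  using assms V.subspace_0[OF subspace_wspace, of b] by (auto simp: wts_def)

lemma act_root_space:
  assumes x: "x \<in> root_space a" and v: "v \<in> wspace b"
  shows "act x v \<in> wspace (b + a)"
proof -
  have "act h (act x v) = scaleV ((b + a) h) (act x v)" if h: "h \<in> H" for h
  proof -
    have "act h (act x v) = act (bracket h x) v + act x (act h v)"
      by (simp add: act_bracket)
    also have "bracket h x = scale (a h) x"
      using x h by (simp add: root_space_def)
    finally show ?thesis
      using act_wspace[OF v h] by (simp add: act.scale act_left.scale V.scale_left_distrib)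
  qed
  then show ?thesis
    by (simp add: wspace_def)
qed

text \<open>Choose \<open>h\<close> with \<open>g h \<noteq> b h\<close>. Then
  \<open>act h - g h\<close> removes the component in \<open>wspace g\<close> and multiplies
  \<open>v\<close> by the nonzero \<open>b h - g h\<close>, which reduces to the smaller
  set.\<close>

lemma wspace_inter_span:
  assumes "finite G" "G \<subseteq> dual" "b \<in> dual" "b \<notin> G"
    and "v \<in> wspace b" "v \<in> V.span (\<Union>g\<in>G. wspace g)"
  shows "v = 0"
  using assms
proof (induction G arbitrary: v rule: finite_induct)
  case (insert g G)
  have "v \<in> V.span (wspace g \<union> (\<Union>g\<in>G. wspace g))"
    using insert.prems(5) by simp
  then obtain w u where w: "w \<in> V.span (wspace g)"
    and u: "u \<in> V.span (\<Union>g\<in>G. wspace g)" and v: "v = w + u"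
    by (auto simp: V.span_Un)
  have w: "w \<in> wspace g"
    using w V.span_eq_iff[of "wspace g"] subspace_wspace by blast
  obtain h where h: "h \<in> H" "g h \<noteq> b h"
    using dual_eqI[of g b] insert.prems by auto
  have stable: "act h y \<in> V.span (\<Union>g\<in>G. wspace g)"
    if "y \<in> V.span (\<Union>g\<in>G. wspace g)" for y
    using that
  proof (induction rule: V.span_induct_alt)
    case (step c x y)
    obtain g' where g': "g' \<in> G" "x \<in> wspace g'"
      using step(1) by blast
    then have "x \<in> V.span (\<Union>g\<in>G. wspace g)"
      by (intro V.span_base) blast
    then have "act h x \<in> V.span (\<Union>g\<in>G. wspace g)"
      using act_wspace[OF g'(2) h(1)] by (simp add: V.span_scale)
    then show ?case
      using step(2) by (simp add: act.add act.scale V.span_add V.span_scale)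
  qed (simp add: act.zero V.span_zero)
  have "scaleV (b h - g h) v = act h u - scaleV (g h) u"
    using act_wspace[OF insert.prems(4) h(1)] act_wspace[OF w h(1)] unfolding v
    by (simp add: act.add V.scale_left_diff_distrib V.scale_right_distrib algebra_simps)
  then have "scaleV (b h - g h) v \<in> V.span (\<Union>g\<in>G. wspace g)"
    using u stable by (simp add: V.span_diff V.span_scale)
  moreover have "scaleV (b h - g h) v \<in> wspace b"
    using insert.prems(4) subspace_wspace by (simp add: V.subspace_scale)
  ultimately have "scaleV (b h - g h) v = 0"
    using insert.IH[of "scaleV (b h - g h) v"] insert.prems by blast
  then show ?case
    using h by simp
qed simp

text \<open>By independence of weight spaces, a nonzero vector of weight \<open>b\<close> is not in
  the span of vectors of other weights. This bounds the weights of a module by those of any spanning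
  set of weight vectors.\<close>

lemma weight_of_spanning_vector:
  assumes v: "v \<in> wspace b" "v \<noteq> 0" "b \<in> dual" "v \<in> V.span T"
    and T: "\<And>t. t \<in> T \<Longrightarrow> t \<in> wspace (wt t)" "\<And>t. t \<in> T \<Longrightarrow> wt t \<in> dual"
  shows "\<exists>t\<in>T. t \<noteq> 0 \<and> wt t = b"
proof (rule ccontr)
  assume none: "\<not> (\<exists>t\<in>T. t \<noteq> 0 \<and> wt t = b)"
  obtain T' r where T': "finite T'" "T' \<subseteq> T" and vsum: "v = (\<Sum>t\<in>T'. scaleV (r t) t)"
    using v(4) by (auto simp: V.span_explicit)
  let ?G = "wt ` (T' - {0})"
  have "v = (\<Sum>t\<in>T' - {0}. scaleV (r t) t)"
    unfolding vsum using T'(1) by (intro sum.mono_neutral_right) auto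
  also have "\<dots> \<in> V.span (\<Union>g\<in>?G. wspace g)"
    using T'(2) T(1) by (intro V.span_sum V.span_scale V.span_base) auto
  finally have "v \<in> V.span (\<Union>g\<in>?G. wspace g)" .
  then have "v = 0"
    using T' T(2) v none by (intro wspace_inter_span[of ?G b]) auto
  with v(2) show False ..
qed

lemma weight_basis_exists:
  assumes "finite C" "V.span C = UNIV" and T: "V.span T = UNIV"
  obtains B where "finite B" "V.independent B" "V.span B = UNIV" "B \<subseteq> T"
proof -
  obtain B where B: "B \<subseteq> T" "V.independent B" "T \<subseteq> V.span B"
    using V.maximal_independent_subset .
  have "finite B"
    using V.independent_span_bound[OF assms(1) B(2)] assms(2) by auto
  moreover have "V.span B = UNIV"
    using T V.span_minimal[OF B(3) V.subspace_span] by auto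
  ultimately show ?thesis
    using that B by blast
qed

lemma finite_wts:
  assumes "finite B" "V.span B = UNIV"
    and "\<And>t. t \<in> B \<Longrightarrow> t \<in> wspace (wt t)" "\<And>t. t \<in> B \<Longrightarrow> wt t \<in> dual"
  shows "finite wts"
proof (rule finite_subset)
  show "wts \<subseteq> wt ` B"
  proof
    fix b assume b: "b \<in> wts"
    then obtain v where v: "v \<in> wspace b" "v \<noteq> 0" by (rule wtsE)
    then have "\<exists>t\<in>B. t \<noteq> 0 \<and> wt t = b"
      using b assms by (intro weight_of_spanning_vector[of v]) (auto simp: wts_def)
    then show "b \<in> wt ` B" by auto
  qed
qed (use assms in simp)

lemma wspace_subset_span_basis:
  assumes "finite B" "V.span B = UNIV" "\<And>t. t \<in> B \<Longrightarrow> t \<in> wspace (wt t)"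
      "\<And>t. t \<in> B \<Longrightarrow> wt t \<in> dual"
    and b: "b \<in> dual" and v: "v \<in> wspace b"
  shows "v \<in> V.span {t \<in> B. wt t = b}"
proof -
  obtain r where r: "v = (\<Sum>t\<in>B. scaleV (r t) t)"
    using assms(1,2) V.span_finite[of B] by blast
  define u where "u = (\<Sum>t\<in>{t \<in> B. wt t = b}. scaleV (r t) t)"
  have split: "v = u + (\<Sum>t\<in>{t \<in> B. wt t \<noteq> b}. scaleV (r t) t)"
    unfolding r u_def using assms(1)
    by (subst sum.union_disjoint[symmetric]) (auto intro!: sum.cong)
  have u: "u \<in> V.span {t \<in> B. wt t = b}"
    unfolding u_def by (intro V.span_sum V.span_scale V.span_base)
  have "u \<in> wspace b"
    unfolding u_def using assms(3)
    by (intro V.subspace_sum[OF subspace_wspace] V.subspace_scale[OF subspace_wspace]) auto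
  then have "v - u \<in> wspace b"
    using v V.subspace_diff[OF subspace_wspace] by blast
  moreover have "v - u \<in> V.span (\<Union>g\<in>wt ` {t \<in> B. wt t \<noteq> b}. wspace g)"
  proof -
    have "v - u = (\<Sum>t\<in>{t \<in> B. wt t \<noteq> b}. scaleV (r t) t)"
      using split by simp
    also have "\<dots> \<in> V.span (\<Union>g\<in>wt ` {t \<in> B. wt t \<noteq> b}. wspace g)"
      using assms(3) by (intro V.span_sum V.span_scale V.span_base) auto
    finally show ?thesis .
  qed
  ultimately have "v - u = 0"
    using assms(1,4) b
    by (intro wspace_inter_span[of "wt ` {t \<in> B. wt t \<noteq> b}" b]) auto
  then show ?thesis
    using u by simp
qed

end

subsection \<open>The root space decomposition\<close>

context lie_algebra
begin

lemma bracket_anticommute: "bracket x y = - bracket y x"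
  using bracket_self[of "x + y"] unfolding bracket_add_left bracket_add_right
  by (simp add: bracket_self eq_neg_iff_add_eq_0 add.commute)

end

sublocale simple_lie_algebra_cartan \<subseteq> ad: cartan_module scale bracket H scale bracket
proof unfold_locales
  fix x y v
  have minus: "bracket a (- b) = - bracket a b" for a b
    using bracket_scale_right[of a "- 1" b] by simp
  show "bracket (bracket x y) v = bracket x (bracket y v) - bracket y (bracket x v)"
    using jacobi[of x y v] bracket_anticommute[of v "bracket x y"] bracket_anticommute[of v x]
    by (simp add: minus algebra_simps eq_neg_iff_add_eq_0)
qed (simp_all add: bracket_add_left bracket_add_right bracket_scale_left bracket_scale_right)

context simple_lie_algebra_cartan
begin

lemma root_space_eq_wspace: "root_space a = ad.wspace a"
  by (simp add: root_space_def ad.wspace_def)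

lemma subspace_root_space: "subspace (root_space a)"
  by (simp add: root_space_eq_wspace ad.subspace_wspace)

lemma bracket_root_space: "\<lbrakk>x \<in> root_space a; h \<in> H\<rbrakk> \<Longrightarrow> bracket h x = scale (a h) x"
  by (simp add: root_space_def)

lemma bracket_root_spaces:
  "\<lbrakk>x \<in> root_space a; y \<in> root_space b\<rbrakk> \<Longrightarrow> bracket x y \<in> root_space (b + a)"
  using ad.act_root_space by (simp add: root_space_eq_wspace)

lemma root_space_0: "root_space 0 = H"
  using H_self_centralizing H_commute by (auto simp: root_space_def)

text \<open>When \<open>h\<close> is added, a joint eigenvector for \<open>F\<close> is split inside
  its joint eigenspace, which \<open>h\<close> preserves because \<open>H\<close> is
  commutative.\<close>

lemma joint_eigenvectors_span:
  assumes "finite F" "F \<subseteq> H"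
  shows "span {x. \<forall>h\<in>F. \<exists>c. bracket h x = scale c x} = UNIV"
  using assms
proof (induction F rule: finite_induct)
  case (insert h F)
  let ?E = "\<lambda>F. {x. \<forall>h\<in>F. \<exists>c. bracket h x = scale c x}"
  have "x \<in> span (?E (insert h F))" if x: "x \<in> ?E F" for x
  proof -
    obtain c where c: "\<And>h'. h' \<in> F \<Longrightarrow> bracket h' x = scale (c h') x"
      using x bchoice[of F "\<lambda>h c. bracket h x = scale c x"] by blast
    let ?W = "{y. \<forall>h'\<in>F. bracket h' y = scale (c h') y}"
    have "subspace ?W"
      by (auto simp: subspace_def ad.act.add ad.act.scale scale_right_distrib mult.commute)
    moreover have "bracket h ` ?W \<subseteq> ?W"
    proof clarsimp
      fix y h' assume y: "\<forall>h'\<in>F. bracket h' y = scale (c h') y" and h': "h' \<in> F"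
      have "bracket h' (bracket h y) = bracket (bracket h' h) y + bracket h (bracket h' y)"
        by (simp add: ad.act_bracket)
      also have "bracket h' h = 0"
        using H_commute insert.prems h' by auto
      finally show "bracket h' (bracket h y) = scale (c h') (bracket h y)"
        using y h' by (simp add: ad.act.scale ad.act_left.zero)
    qed
    ultimately have "x \<in> span {y \<in> ?W. \<exists>c. bracket h y = scale c y}"
      using c insert.prems H_diagonalizable
      by (intro diagonalizable_on_stable_subspace[OF ad.act.linear_axioms]) auto
    also have "\<dots> \<subseteq> span (?E (insert h F))"
      by (rule span_mono) auto
    finally show ?thesis .
  qed
  then have "?E F \<subseteq> span (?E (insert h F))"
    by blast
  then have "span (?E F) \<subseteq> span (?E (insert h F))"
    by (rule span_minimal) (rule subspace_span)
  then show ?case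
    using insert.IH insert.prems by auto
qed simp

lemma root_space_of_joint_eigenvector:
  assumes "x \<noteq> 0" "\<And>h. h \<in> H \<Longrightarrow> \<exists>c. bracket h x = scale c x"
  obtains b where "b \<in> dual" "x \<in> root_space b"
proof -
  obtain c where c: "\<And>h. h \<in> H \<Longrightarrow> bracket h x = scale (c h) x"
    using bchoice[of H "\<lambda>h c. bracket h x = scale c x"] assms(2) by blast
  \<comment> \<open>The value 0 outside \<open>H\<close> is the convention of
    \<open>dual\<close>.\<close>
  define b where "b h = (if h \<in> H then c h else 0)" for h
  have H_closed: "\<And>h h'. \<lbrakk>h \<in> H; h' \<in> H\<rbrakk> \<Longrightarrow> h + h' \<in> H" "\<And>h r. h \<in> H \<Longrightarrow> scale r h \<in> H"
    using subspace_H by (auto simp: subspace_add subspace_scale)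
  have b: "bracket h x = scale (b h) x" if "h \<in> H" for h
    using c that by (simp add: b_def)
  have "b (h + h') = b h + b h'" if "h \<in> H" "h' \<in> H" for h h'
  proof -
    have "scale (b (h + h')) x = scale (b h + b h') x"
      unfolding scale_left_distrib b[OF that(1), symmetric] b[OF that(2), symmetric]
        b[OF H_closed(1)[OF that], symmetric]
      by (rule ad.act_left.add)
    then show ?thesis using assms(1) by simp
  qed
  moreover have "b (scale r h) = r * b h" if "h \<in> H" for r h
  proof -
    have "scale (b (scale r h)) x = scale (r * b h) x"
      unfolding scale_scale[symmetric] b[OF that, symmetric]
        b[OF H_closed(2)[OF that], symmetric]
      by (rule ad.act_left.scale)
    then show ?thesis using assms(1) by simp
  qed
  ultimately have "b \<in> dual"
    by (auto simp: dual_def b_def)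
  then show ?thesis
    using that b by (auto simp: root_space_def)
qed

lemma finite_basis_subset:
  assumes "subspace W"
  obtains F where "finite F" "F \<subseteq> W" "independent F" "span F = W"
proof -
  obtain B where "finite B" "span B = UNIV"
    using finite_dim by blast
  moreover obtain F where F: "F \<subseteq> W" "independent F" "W \<subseteq> span F"
    using maximal_independent_subset .
  ultimately have "finite F"
    using independent_span_bound[of B F] by auto
  then show ?thesis
    using that F span_minimal[OF F(1) assms] by auto
qed

lemma root_spaces_span: "span (\<Union>b\<in>dual. root_space b) = UNIV"
proof -
  obtain F where F: "finite F" "F \<subseteq> H" "span F = H"
    using finite_basis_subset[OF subspace_H] by metis
  have "x \<in> span (\<Union>b\<in>dual. root_space b)"
    if x: "\<forall>h\<in>F. \<exists>c. bracket h x = scale c x" for x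
  proof (cases "x = 0")
    case False
    \<comment> \<open>A finite spanning set of \<open>H\<close> is enough: a joint eigenvector for
      it is one for all of \<open>H\<close>.\<close>
    have "\<exists>c. bracket h x = scale c x" if "h \<in> span F" for h
      using that
    proof (induction rule: span_induct_alt)
      case base
      then show ?case
        by (intro exI[of _ 0]) (simp add: ad.act_left.zero)
    next
      case (step r h h')
      obtain c c' where "bracket h x = scale c x" "bracket h' x = scale c' x"
        using step x by blast
      then show ?case
        by (intro exI[of _ "r * c + c'"])
          (simp add: ad.act_left.add ad.act_left.scale scale_left_distrib)
    qed
    then obtain b where "b \<in> dual" "x \<in> root_space b"
      using root_space_of_joint_eigenvector[OF False] F(3) by blast
    then show ?thesis
      by (auto intro: span_base)
  qed (simp add: span_zero)
  then have "{x. \<forall>h\<in>F. \<exists>c. bracket h x = scale c x} \<subseteq> span (\<Union>b\<in>dual. root_space b)"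
    by blast
  then have "span {x. \<forall>h\<in>F. \<exists>c. bracket h x = scale c x} \<subseteq> span (\<Union>b\<in>dual. root_space b)"
    by (rule span_minimal) (rule subspace_span)
  then show ?thesis
    using joint_eigenvectors_span[OF F(1,2)] by auto
qed

lemma root_basis_exists:
  obtains B wt where "finite B" "independent B" "span B = UNIV"
    and "\<And>t. t \<in> B \<Longrightarrow> t \<in> root_space (wt t)" "\<And>t. t \<in> B \<Longrightarrow> wt t \<in> dual"
proof -
  obtain C where "finite C" "span C = UNIV"
    using finite_dim by blast
  then obtain B where B: "finite B" "independent B" "span B = UNIV"
      "B \<subseteq> (\<Union>b\<in>dual. root_space b)"
    using ad.weight_basis_exists[OF _ _ root_spaces_span] by metis
  then have "\<forall>t\<in>B. \<exists>b. b \<in> dual \<and> t \<in> root_space b"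
    by blast
  then obtain wt where "\<forall>t\<in>B. wt t \<in> dual \<and> t \<in> root_space (wt t)"
    using bchoice[of B "\<lambda>t b. b \<in> dual \<and> t \<in> root_space b"] by blast
  then show ?thesis
    using that[OF B(1-3), of wt] by blast
qed

lemma finite_ad_wts: "finite ad.wts"
proof -
  obtain B wt where "finite B" "span B = UNIV"
      "\<And>t. t \<in> B \<Longrightarrow> t \<in> root_space (wt t)" "\<And>t. t \<in> B \<Longrightarrow> wt t \<in> dual"
    using root_basis_exists by metis
  then show ?thesis
    unfolding root_space_eq_wspace by (rule ad.finite_wts)
qed

lemma roots_eq_ad_wts: "roots = ad.wts - {0}"
  by (auto simp: roots_def ad.wts_def root_space_eq_wspace)

lemma finite_roots: "finite roots"
  using finite_ad_wts by (simp add: roots_eq_ad_wts)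

lemma rootsI: "\<lbrakk>a \<in> dual; a \<noteq> 0; x \<in> root_space a; x \<noteq> 0\<rbrakk> \<Longrightarrow> a \<in> roots"
  by (auto simp: roots_def)

lemma rootsE:
  assumes "a \<in> roots"
  obtains x where "x \<in> root_space a" "x \<noteq> 0"
  using assms subspace_0[OF subspace_root_space, of a] by (auto simp: roots_def)

lemma root_space_trivial: "\<lbrakk>a \<in> dual; a \<noteq> 0; a \<notin> roots; x \<in> root_space a\<rbrakk> \<Longrightarrow> x = 0"
  using rootsI by blast

lemma span_H_root_spaces: "span (H \<union> (\<Union>a\<in>roots. root_space a)) = UNIV"
proof -
  have "x \<in> span (H \<union> (\<Union>a\<in>roots. root_space a))" if "x \<in> root_space b" "b \<in> dual" for x b
  proof (cases "x = 0 \<or> x \<in> H")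
    case True
    then show ?thesis
      by (auto simp: span_zero span_base)
  next
    case False
    then have "b \<in> roots"
      using that root_space_0 by (cases "b = 0") (auto intro: rootsI)
    then show ?thesis
      using that(1) by (blast intro: span_base)
  qed
  then have "(\<Union>b\<in>dual. root_space b) \<subseteq> span (H \<union> (\<Union>a\<in>roots. root_space a))"
    by blast
  then have "span (\<Union>b\<in>dual. root_space b) \<subseteq> span (H \<union> (\<Union>a\<in>roots. root_space a))"
    by (rule span_minimal) (rule subspace_span)
  then show ?thesis
    using root_spaces_span by auto
qed

end

subsection \<open>Coroots and the Killing form\<close>

lemma (in vector_space) linear_image_span_subset:
  assumes "Vector_Spaces.linear scale scale f" "f ` S \<subseteq> span S" "x \<in> span S"
  shows "f x \<in> span S"
proof -
  interpret Vector_Spaces.linear scale scale f by fact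
  show ?thesis
    using assms(3)
  proof (induction rule: span_induct_alt)
    case (step c x y)
    then have "f x \<in> span S"
      using assms(2) by blast
    then show ?case
      using step(2) by (simp add: local.add local.scale span_add span_scale)
  qed (simp add: zero span_zero)
qed

context simple_lie_algebra_cartan
begin

text \<open>This is \<open>[g_a, g_{-a}]\<close>, the space from which \<open>coroot\<close> is
  chosen; for a root it turns out to be the line through the coroot.\<close>

definition coroot_span :: "('a \<Rightarrow> complex) \<Rightarrow> 'a set" where
  "coroot_span a = span {bracket x y | x y. x \<in> root_space a \<and> y \<in> root_space (- a)}"

lemma bracket_opposite_mem_H: "\<lbrakk>x \<in> root_space a; y \<in> root_space (- a)\<rbrakk> \<Longrightarrow> bracket x y \<in> H"
  using bracket_root_spaces[of x a y "- a"] root_space_0 by simp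

lemma coroot_span_subset_H: "coroot_span a \<subseteq> H"
  unfolding coroot_span_def
  by (rule span_minimal[OF _ subspace_H]) (auto intro: bracket_opposite_mem_H)

lemma bracket_mem_coroot_span:
  "\<lbrakk>x \<in> root_space a; y \<in> root_space (- a)\<rbrakk> \<Longrightarrow> bracket x y \<in> coroot_span a"
  unfolding coroot_span_def by (intro span_base) blast

lemma ideal_subspace_trivial:
  assumes "subspace I" "\<And>x y. y \<in> I \<Longrightarrow> bracket x y \<in> I"
  shows "I = {0} \<or> I = UNIV"
  using assms by (intro ideal_trivial) (auto simp: ideal_def)

text \<open>Such an \<open>h\<close> commutes with \<open>H\<close> and with all root spaces, hence
  is central; the center is an ideal and, as the algebra is not abelian, it is zero.\<close>

lemma root_annihilator_trivial:
  assumes h: "h \<in> H" "\<And>b. b \<in> roots \<Longrightarrow> b h = 0"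
  shows "h = 0"
proof -
  let ?Z = "{x. \<forall>y. bracket y x = 0}"
  have Z: "?Z = {0} \<or> ?Z = UNIV"
    by (rule ideal_subspace_trivial)
      (auto simp: subspace_def ad.act.add ad.act.scale ad.act.zero)
  moreover have "?Z \<noteq> UNIV"
    using nonabelian by blast
  moreover have "bracket h y = 0" for y
  proof -
    have "y \<in> span (H \<union> (\<Union>a\<in>roots. root_space a))"
      by (simp add: span_H_root_spaces)
    then show ?thesis
    proof (induction rule: span_induct_alt)
      case (step c x y)
      then have "bracket h x = 0"
        using h H_commute bracket_root_space[OF _ h(1)] by auto
      then show ?case
        using step by (simp add: ad.act.add ad.act.scale)
    qed (rule ad.act.zero)
  qed
  ultimately show ?thesis
    using bracket_anticommute[of _ h] by auto
qed

lemma derived_algebra: "span {bracket x y | x y. True} = UNIV"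
proof -
  let ?D = "span {bracket x y | x y. True}"
  have "?D = {0} \<or> ?D = UNIV"
    by (rule ideal_subspace_trivial) (auto intro: span_base)
  moreover have "?D \<noteq> {0}"
    using nonabelian span_base[of _ "{bracket x y | x y. True}"] by blast
  ultimately show ?thesis
    by blast
qed

end

text \<open>A fixed basis of root vectors makes traces computable. Conclusions that do not mention
  the basis are carried back to \<open>simple_lie_algebra_cartan\<close> through
  \<open>root_basis_locale_exists\<close>.\<close>

locale root_basis = simple_lie_algebra_cartan scale bracket H
  for scale :: "complex \<Rightarrow> 'g::ab_group_add \<Rightarrow> 'g"
    and bracket :: "'g \<Rightarrow> 'g \<Rightarrow> 'g"
    and H :: "'g set" +
  fixes B :: "'g set" and wt :: "'g \<Rightarrow> 'g \<Rightarrow> complex"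
  assumes finite_B: "finite B" and independent_B: "independent B" and span_B: "span B = UNIV"
    and B_root_space: "t \<in> B \<Longrightarrow> t \<in> root_space (wt t)"
    and wt_dual: "t \<in> B \<Longrightarrow> wt t \<in> dual"
begin

lemma root_space_subset_span:
  "\<lbrakk>b \<in> dual; x \<in> root_space b\<rbrakk> \<Longrightarrow> x \<in> span {t \<in> B. wt t = b}"
  using ad.wspace_subset_span_basis[OF finite_B span_B] B_root_space wt_dual
  unfolding root_space_eq_wspace by blast

lemma root_is_wt: "b \<in> roots \<Longrightarrow> \<exists>t\<in>B. wt t = b"
proof -
  assume b: "b \<in> roots"
  then obtain x where x: "x \<in> root_space b" "x \<noteq> 0" by (rule rootsE)
  then have "x \<in> span {t \<in> B. wt t = b}"
    using b by (intro root_space_subset_span) (auto simp: roots_dual)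
  then show "\<exists>t\<in>B. wt t = b"
    using x(2) by (cases "{t \<in> B. wt t = b} = {}") auto
qed

definition "string" :: "('g \<Rightarrow> complex) \<Rightarrow> ('g \<Rightarrow> complex) \<Rightarrow> 'g set" where
  "string a b = {t \<in> B. \<exists>n::int. wt t = b + fscale (of_int n) a}"

lemma bracket_string:
  assumes a: "a \<in> dual" and x: "x \<in> root_space (fscale (of_int j) a)"
  shows "bracket x ` string a b \<subseteq> span (string a b)"
proof
  fix z assume "z \<in> bracket x ` string a b"
  then obtain t n where t: "t \<in> B" "wt t = b + fscale (of_int n) a" and z: "z = bracket x t"
    by (auto simp: string_def)
  have "z \<in> root_space (wt t + fscale (of_int j) a)"
    unfolding z using x t(1) B_root_space by (intro bracket_root_spaces) auto
  then have "z \<in> span {s \<in> B. wt s = wt t + fscale (of_int j) a}"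
    using t(1) a by (intro root_space_subset_span) (auto intro: dual_closed wt_dual)
  also have "\<dots> \<subseteq> span (string a b)"
  proof (rule span_mono, rule subsetI)
    fix s assume s: "s \<in> {s \<in> B. wt s = wt t + fscale (of_int j) a}"
    then have "wt s = b + fscale (of_int (n + j)) a"
      using t(2) by (auto simp: fun_eq_iff algebra_simps)
    then show "s \<in> string a b"
      using s unfolding string_def by blast
  qed
  finally show "z \<in> span (string a b)" .
qed

text \<open>The left side is the trace of \<open>[x, y]\<close> on the string, where it acts
  diagonally; as a commutator of two operators preserving the span it has trace 0.\<close>

lemma string_trace:
  assumes a: "a \<in> dual" and x: "x \<in> root_space a" and y: "y \<in> root_space (- a)"
  shows "(\<Sum>t\<in>string a b. wt t (bracket x y)) = 0"
proof -
  let ?S = "string a b"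
  have "fscale (of_int 1) a = a" "fscale (of_int (- 1)) a = - a"
    by (auto simp: fun_eq_iff)
  then have xS: "bracket x ` ?S \<subseteq> span ?S" and yS: "bracket y ` ?S \<subseteq> span ?S"
    using bracket_string[OF a, of x 1] bracket_string[OF a, of y "- 1"] x y by auto
  have fin: "finite ?S" and ind: "independent ?S"
    using finite_B independent_B independent_mono[of B ?S] by (auto simp: string_def)
  have xy: "(\<lambda>t. bracket x (bracket y t)) ` ?S \<subseteq> span ?S"
      "(\<lambda>t. bracket y (bracket x t)) ` ?S \<subseteq> span ?S"
    using linear_image_span_subset[OF ad.act.linear_axioms xS]
      linear_image_span_subset[OF ad.act.linear_axioms yS] xS yS by auto
  have "(\<Sum>t\<in>?S. wt t (bracket x y)) = trace_on scale ?S (bracket (bracket x y))"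
    using ind B_root_space bracket_opposite_mem_H[OF x y]
    by (intro trace_on_diagonal[symmetric]) (auto simp: string_def bracket_root_space)
  also have "\<dots> = trace_on scale ?S (\<lambda>t. bracket x (bracket y t) - bracket y (bracket x t))"
    by (simp add: ad.act_bracket[abs_def])
  also have "\<dots> = 0"
    using trace_on_diff[OF ind xy]
      trace_on_commute[OF fin ind ad.act.linear_axioms xS ad.act.linear_axioms yS] by simp
  finally show ?thesis .
qed

lemma string_sum_eq_0:
  assumes a: "a \<in> dual" and h: "h \<in> coroot_span a"
  shows "(\<Sum>t\<in>string a b. wt t h) = 0"
proof -
  have wt: "wt t \<in> dual" if "t \<in> string a b" for t
    using that wt_dual by (simp add: string_def)
  from h have "h \<in> H \<and> (\<Sum>t\<in>string a b. wt t h) = 0"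
    unfolding coroot_span_def
  proof (induction rule: span_induct_alt)
    case base
    then show ?case
      using wt subspace_0[OF subspace_H] by (simp add: dual_apply_0)
  next
    case (step c x y)
    have x: "x \<in> H" "(\<Sum>t\<in>string a b. wt t x) = 0"
      using step(1) string_trace[OF a] bracket_opposite_mem_H by auto
    have "(\<Sum>t\<in>string a b. wt t (scale c x + y))
        = c * (\<Sum>t\<in>string a b. wt t x) + (\<Sum>t\<in>string a b. wt t y)"
      using x(1) step(2) wt subspace_scale[OF subspace_H]
      by (simp add: dual_apply_add dual_apply_scale sum.distrib sum_distrib_left)
    then show ?case
      using x step(2) subspace_H by (simp add: subspace_add subspace_scale)
  qed
  then show ?thesis ..
qed

text \<open>Weights along the string of \<open>s\<close> are \<open>wt s + n a\<close>, so the
  vanishing trace can be solved for \<open>wt s\<close> in terms of \<open>a\<close>. That the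
  factor is real is what makes the sum of squares in \<open>killing_nondegenerate\<close>
  positive.\<close>

lemma wt_proportional:
  assumes a: "a \<in> dual" and s: "s \<in> B"
  shows "\<exists>q\<in>\<real>. \<forall>h\<in>coroot_span a. wt s h = q * a h"
proof -
  let ?S = "string a (wt s)"
  have "\<forall>t\<in>?S. \<exists>n::int. wt t = wt s + fscale (of_int n) a"
    by (simp add: string_def)
  then obtain n :: "'g \<Rightarrow> int" where n: "\<And>t. t \<in> ?S \<Longrightarrow> wt t = wt s + fscale (of_int (n t)) a"
    using bchoice[of ?S "\<lambda>t n. wt t = wt s + fscale (of_int n) a"] by blast
  have "s \<in> ?S"
    using s by (auto simp: string_def fun_eq_iff intro!: exI[of _ 0])
  moreover have "finite ?S"
    using finite_B by (simp add: string_def)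
  ultimately have card: "card ?S \<noteq> 0"
    by auto
  let ?q = "- of_int (\<Sum>t\<in>?S. n t) / of_nat (card ?S) :: complex"
  have "wt s h = ?q * a h" if h: "h \<in> coroot_span a" for h
  proof -
    have "0 = (\<Sum>t\<in>?S. wt s h + of_int (n t) * a h)"
      using string_sum_eq_0[OF a h, of "wt s"] n by (simp cong: sum.cong)
    also have "\<dots> = of_nat (card ?S) * wt s h + of_int (\<Sum>t\<in>?S. n t) * a h"
      by (simp add: sum.distrib sum_distrib_right)
    finally show ?thesis
      using card by (simp add: field_simps eq_neg_iff_add_eq_0 add.commute)
  qed
  moreover have "?q \<in> \<real>"
    by (intro Reals_divide Reals_minus) auto
  ultimately show ?thesis
    by blast
qed

section \<open>The Killing form in the chosen basis\<close>

definition killing :: "'g \<Rightarrow> 'g \<Rightarrow> complex" where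
  "killing x y = trace_on scale B (\<lambda>t. bracket x (bracket y t))"

lemma trace_B_commute:
  assumes "Vector_Spaces.linear scale scale f" "Vector_Spaces.linear scale scale g"
  shows "trace_on scale B (\<lambda>t. f (g t)) = trace_on scale B (\<lambda>t. g (f t))"
  using trace_on_commute[OF finite_B independent_B assms(1) _ assms(2)] by (simp add: span_B)

lemma killing_commute: "killing x y = killing y x"
  unfolding killing_def by (rule trace_B_commute[OF ad.act.linear_axioms ad.act.linear_axioms])

lemma killing_add: "killing (x + y) z = killing x z + killing y z"
  unfolding killing_def ad.act_left.add
  by (rule trace_on_add[OF independent_B]) (simp_all add: span_B)

lemma killing_scale: "killing (scale c x) z = c * killing x z"
  unfolding killing_def ad.act_left.scale
  by (rule trace_on_scale[OF independent_B]) (simp_all add: span_B)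

text \<open>The two expansions agree once \<open>ad y\<close> is moved cyclically past
  \<open>ad x ad z\<close>.\<close>

lemma killing_bracket: "killing (bracket x y) z = killing x (bracket y z)"
proof -
  have lin: "Vector_Spaces.linear scale scale (\<lambda>t. bracket x (bracket z t))"
    using Vector_Spaces.linear_compose[OF ad.act.linear_axioms ad.act.linear_axioms, of x z]
    by (simp add: o_def)
  have "killing (bracket x y) z
      = trace_on scale B (\<lambda>t. bracket x (bracket y (bracket z t)))
        - trace_on scale B (\<lambda>t. bracket y (bracket x (bracket z t)))"
    unfolding killing_def ad.act_bracket
    by (rule trace_on_diff[OF independent_B]) (simp_all add: span_B)
  also have "trace_on scale B (\<lambda>t. bracket y (bracket x (bracket z t)))
      = trace_on scale B (\<lambda>t. bracket x (bracket z (bracket y t)))"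
    by (rule trace_B_commute[OF ad.act.linear_axioms lin])
  also have "trace_on scale B (\<lambda>t. bracket x (bracket y (bracket z t))) - \<dots>
      = killing x (bracket y z)"
    unfolding killing_def ad.act_bracket ad.act.diff
    by (rule trace_on_diff[OF independent_B, symmetric]) (simp_all add: span_B)
  finally show ?thesis .
qed

lemma killing_H: "h \<in> H \<Longrightarrow> killing h h = (\<Sum>t\<in>B. (wt t h)\<^sup>2)"
  unfolding killing_def
  by (rule trace_on_diagonal[OF independent_B])
    (simp add: bracket_root_space[OF B_root_space] ad.act.scale power2_eq_square)

end

context simple_lie_algebra_cartan
begin

lemma root_basis_locale_exists:
  obtains B wt where "root_basis scale bracket H B wt"
proof -
  obtain B wt where "finite B" "independent B" "span B = UNIV"
    and "\<And>t. t \<in> B \<Longrightarrow> t \<in> root_space (wt t)" "\<And>t. t \<in> B \<Longrightarrow> wt t \<in> dual"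
    using root_basis_exists by metis
  then have "root_basis scale bracket H B wt"
    by unfold_locales
  then show ?thesis ..
qed

lemma coroot_span_proportional:
  assumes "a \<in> dual" "b \<in> roots"
  shows "\<exists>q. \<forall>h\<in>coroot_span a. b h = q * a h"
proof -
  obtain B wt where "root_basis scale bracket H B wt"
    by (rule root_basis_locale_exists)
  then interpret root_basis scale bracket H B wt .
  show ?thesis
    using root_is_wt[OF assms(2)] wt_proportional[OF assms(1)] by blast
qed

lemma coroot_span_eq_0:
  assumes "a \<in> dual" "h \<in> coroot_span a" "a h = 0"
  shows "h = 0"
proof (rule root_annihilator_trivial)
  show "h \<in> H"
    using assms(2) coroot_span_subset_H by blast
  show "b h = 0" if "b \<in> roots" for b
    using coroot_span_proportional[OF assms(1) that] assms(2,3) by auto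
qed

text \<open>Otherwise all brackets lie in the span of the root spaces, which is then the whole
  algebra by \<open>derived_algebra\<close>. As this span meets \<open>H\<close> in 0,
  \<open>H\<close> is zero; being its own centralizer it is also everything, so the algebra would be
  zero.\<close>

lemma nonzero_root_bracket_exists:
  "\<exists>a\<in>roots. \<exists>x\<in>root_space a. \<exists>y\<in>root_space (- a). bracket x y \<noteq> 0"
proof (rule ccontr)
  assume none: "\<not> ?thesis"
  let ?N = "span (\<Union>a\<in>roots. root_space a)" and ?R = "\<Union>b\<in>dual. root_space b"
  have base: "bracket x y \<in> ?N" if "x \<in> ?R" "y \<in> ?R" for x y
  proof -
    obtain a b where a: "a \<in> dual" "x \<in> root_space a" and b: "b \<in> dual" "y \<in> root_space b"
      using \<open>x \<in> ?R\<close> \<open>y \<in> ?R\<close> by blast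
    have xy: "bracket x y \<in> root_space (b + a)"
      using a b by (intro bracket_root_spaces)
    show ?thesis
    proof (cases "b + a \<in> roots \<or> bracket x y = 0")
      case True
      then show ?thesis
        using xy by (auto intro: span_base span_zero)
    next
      case False
      then have "b + a = 0"
        using rootsI[OF _ _ xy] a b dual_closed by blast
      then have "b = - a"
        by (simp add: add_eq_0_iff)
      then have "a \<notin> roots"
        using none a b False by blast
      then have "x = 0 \<or> a = 0"
        using a root_space_trivial by blast
      moreover have "bracket x y = 0" if "a = 0"
        using a(2) b(2) \<open>b = - a\<close> that by (simp add: root_space_0 H_commute)
      ultimately have "bracket x y = 0"
        using ad.act_left.zero by blast
      then show ?thesis
        using False by blast
    qed
  qed
  have "bracket x y \<in> ?N" for x y
  proof -
    have "x \<in> span ?R" "y \<in> span ?R"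
      by (simp_all add: root_spaces_span)
    have "bracket x' y \<in> ?N" if x': "x' \<in> ?R" for x'
      using \<open>y \<in> span ?R\<close>
      by (induction rule: span_induct_alt)
        (simp_all add: ad.act.zero ad.act.add ad.act.scale span_zero span_add span_scale
          base[OF x'] del: UN_iff)
    with \<open>x \<in> span ?R\<close> show ?thesis
      by (induction rule: span_induct_alt)
        (simp_all add: ad.act_left.zero ad.act_left.add ad.act_left.scale span_zero span_add
          span_scale del: UN_iff)
  qed
  then have "span {bracket x y | x y. True} \<subseteq> ?N"
    by (intro span_minimal) auto
  then have N: "?N = UNIV"
    using derived_algebra by blast
  have "h = 0" if "h \<in> H" for h
  proof (rule ad.wspace_inter_span[OF finite_roots _ dual_0])
    show "h \<in> ad.wspace 0" "h \<in> span (\<Union>a\<in>roots. ad.wspace a)"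
      using that N by (simp_all add: root_space_eq_wspace[symmetric] root_space_0)
  qed (use roots_dual roots_nonzero in auto)
  then have "x = 0" for x :: 'a
    using H_self_centralizing[of x] ad.act_left.zero by metis
  then show False
    using nonabelian by blast
qed

end

context root_basis
begin

text \<open>The radical is an ideal, so one nonzero value suffices. For a nonzero
  \<open>h = [x, y]\<close> from opposite root spaces every \<open>wt t h\<close> is a real multiple
  \<open>q t\<close> of \<open>a h\<close>, hence \<open>killing h h\<close> is
  \<open>(a h)^2\<close> times a sum of real squares, one of which is 1.\<close>

lemma killing_nondegenerate:
  assumes "\<And>y. killing x y = 0"
  shows "x = 0"
proof -
  let ?R = "{x. \<forall>y. killing x y = 0}"
  have "?R = {0} \<or> ?R = UNIV"
  proof (rule ideal_subspace_trivial)
    show "subspace ?R"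
      using killing_scale[of 0 0] by (auto simp: subspace_def killing_add killing_scale)
    show "bracket z y \<in> ?R" if "y \<in> ?R" for z y
      using that killing_bracket[of y z] killing_scale[of "- 1" "bracket y z"]
        bracket_anticommute[of z y] by auto
  qed
  moreover have "?R \<noteq> UNIV"
  proof -
    obtain a x y where a: "a \<in> roots" and xy: "x \<in> root_space a" "y \<in> root_space (- a)"
      and nz: "bracket x y \<noteq> 0"
      using nonzero_root_bracket_exists by blast
    define h where "h = bracket x y"
    have h: "h \<in> coroot_span a" "h \<in> H"
      using bracket_mem_coroot_span[OF xy] coroot_span_subset_H by (auto simp: h_def)
    have ah: "a h \<noteq> 0"
      using coroot_span_eq_0[OF roots_dual[OF a] h(1)] nz by (auto simp: h_def)
    have "\<exists>q::real. wt t h = of_real q * a h" if "t \<in> B" for t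
      using wt_proportional[OF roots_dual[OF a] that] h(1) by (auto elim: Reals_cases)
    then obtain q :: "'g \<Rightarrow> real" where q: "\<And>t. t \<in> B \<Longrightarrow> wt t h = of_real (q t) * a h"
      using bchoice[of B "\<lambda>t q. wt t h = complex_of_real q * a h"] by blast
    obtain s where s: "s \<in> B" "wt s = a"
      using root_is_wt[OF a] by blast
    then have "q s = 1"
      using q[OF s(1)] ah by auto
    then have "(\<Sum>t\<in>B. (q t)\<^sup>2) > 0"
      using s(1) finite_B by (intro sum_pos2[of B s]) auto
    moreover have "killing h h = of_real (\<Sum>t\<in>B. (q t)\<^sup>2) * (a h)\<^sup>2"
      unfolding killing_H[OF h(2)] of_real_sum sum_distrib_right
      by (intro sum.cong) (simp_all add: q power_mult_distrib)
    ultimately have "killing h h \<noteq> 0"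
      using ah by (simp del: of_real_sum of_real_power)
    then show ?thesis
      by blast
  qed
  ultimately show ?thesis
    using assms by blast
qed

text \<open>Invariance applied to \<open>h\<close> gives
  \<open>(a h + b h) * killing x y = 0\<close> for every \<open>h\<close> in
  \<open>H\<close>.\<close>

lemma killing_root_spaces:
  assumes a: "a \<in> dual" "x \<in> root_space a" and b: "b \<in> dual" "y \<in> root_space b"
    and nz: "killing x y \<noteq> 0"
  shows "b = - a"
proof (rule dual_eqI)
  fix h assume h: "h \<in> H"
  have "killing x (bracket h y) = killing (bracket x h) y"
    by (simp add: killing_bracket)
  moreover have "bracket x h = scale (- a h) x"
    using bracket_anticommute[of x h] bracket_root_space[OF a(2) h] by simp
  ultimately have "b h * killing x y = - a h * killing x y"
    using bracket_root_space[OF b(2) h] killing_commute killing_scale by metis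
  then have "(b h + a h) * killing x y = 0"
    by (simp add: algebra_simps)
  then show "b h = (- a) h"
    using nz by (simp add: eq_neg_iff_add_eq_0)
qed (use a b in \<open>auto intro: dual_closed\<close>)

text \<open>A basis vector \<open>t\<close> paired nontrivially with \<open>x\<close> has weight
  \<open>- a\<close>. If \<open>[x, t]\<close> were 0, then
  \<open>a h * killing x t = killing [h, x] t = killing [x, t] h\<close> would vanish for an
  \<open>h\<close> with \<open>a h \<noteq> 0\<close>.\<close>

lemma root_vector_bracket_nonzero:
  assumes a: "a \<in> roots" and x: "x \<in> root_space a" "x \<noteq> 0"
  shows "\<exists>y\<in>root_space (- a). bracket x y \<noteq> 0"
proof -
  obtain y where y: "killing y x \<noteq> 0"
    using killing_nondegenerate[of x] x(2) killing_commute by metis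
  obtain t where t: "t \<in> B" "killing t x \<noteq> 0"
  proof (rule ccontr)
    assume none: "\<not> thesis"
    have "y \<in> span B"
      by (simp add: span_B)
    then have "killing y x = 0"
    proof (induction rule: span_induct_alt)
      case base
      then show ?case
        using killing_scale[of 0 0] by simp
    next
      case (step c u v)
      then show ?case
        using that none by (auto simp: killing_add killing_scale)
    qed
    then show False
      using y by simp
  qed
  have "wt t = - a"
    using killing_root_spaces[OF roots_dual[OF a] x(1), of "wt t" t] t
    by (simp add: wt_dual B_root_space killing_commute)
  then have "t \<in> root_space (- a)"
    using B_root_space[OF t(1)] by simp
  moreover have "bracket x t \<noteq> 0"
  proof
    assume 0: "bracket x t = 0"
    obtain h where h: "h \<in> H" "a h \<noteq> 0"
      using dual_eqI[of a 0] roots_dual[OF a] roots_nonzero[OF a] dual_0 by auto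
    have "a h * killing x t = killing (bracket h x) t"
      using bracket_root_space[OF x(1) h(1)] by (simp add: killing_scale)
    also have "\<dots> = killing (bracket x t) h"
      by (simp add: killing_bracket killing_commute[of h])
    also have "\<dots> = 0"
      using 0 killing_scale[of 0 0] by simp
    finally show False
      using h t(2) by (simp add: killing_commute)
  qed
  ultimately show ?thesis
    by blast
qed

end

section \<open>Coroots and sl2-triples\<close>

context simple_lie_algebra_cartan
begin

text \<open>Existence comes from rescaling a nonzero bracket, uniqueness from the fact that
  \<open>a\<close> vanishes on no nonzero element of \<open>coroot_span a\<close>. This gives
  meaning to the description in \<open>coroot\<close>.\<close>

lemma coroot_unique:
  assumes a: "a \<in> roots"
  shows "\<exists>!h. h \<in> coroot_span a \<and> a h = 2"
proof -
  obtain B wt where "root_basis scale bracket H B wt"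
    by (rule root_basis_locale_exists)
  then interpret root_basis scale bracket H B wt .
  obtain x where x: "x \<in> root_space a" "x \<noteq> 0"
    using a by (rule rootsE)
  then obtain y where y: "y \<in> root_space (- a)" "bracket x y \<noteq> 0"
    using root_vector_bracket_nonzero[OF a] by blast
  define h where "h = bracket x y"
  have h: "h \<in> coroot_span a" "h \<in> H" "a h \<noteq> 0"
    using bracket_mem_coroot_span[OF x(1) y(1)] coroot_span_subset_H
      coroot_span_eq_0[OF roots_dual[OF a]] y(2) by (auto simp: h_def)
  have "scale (2 / a h) h \<in> coroot_span a" "a (scale (2 / a h) h) = 2"
    using h dual_apply_scale[OF roots_dual[OF a] h(2)]
    by (auto simp: coroot_span_def span_scale)
  moreover have "u = v"
    if "u \<in> coroot_span a \<and> a u = 2" "v \<in> coroot_span a \<and> a v = 2" for u v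
  proof -
    have "u \<in> H" "v \<in> H"
      using that coroot_span_subset_H by auto
    then have "a (u - v) = 0"
      using that dual_apply_add[OF roots_dual[OF a], of "u - v" v] subspace_diff[OF subspace_H]
      by simp
    moreover have "u - v \<in> coroot_span a"
      using that by (simp add: coroot_span_def span_diff)
    ultimately show ?thesis
      using coroot_span_eq_0[OF roots_dual[OF a], of "u - v"] by simp
  qed
  ultimately show ?thesis
    by blast
qed

lemma coroot_mem_span: "a \<in> roots \<Longrightarrow> coroot a \<in> coroot_span a"
  and root_coroot: "a \<in> roots \<Longrightarrow> a (coroot a) = 2"
  using theI'[OF coroot_unique, of a] unfolding coroot_def coroot_span_def by auto

lemma coroot_mem_H: "a \<in> roots \<Longrightarrow> coroot a \<in> H"
  using coroot_mem_span coroot_span_subset_H by blast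

lemma coroot_span_eq_scale:
  assumes a: "a \<in> roots" and h: "h \<in> coroot_span a"
  shows "h = scale (a h / 2) (coroot a)"
proof -
  have "h - scale (a h / 2) (coroot a) = 0"
  proof (rule coroot_span_eq_0[OF roots_dual[OF a]])
    show mem: "h - scale (a h / 2) (coroot a) \<in> coroot_span a"
      using h coroot_mem_span[OF a] by (simp add: coroot_span_def span_diff span_scale)
    have "a h = a (h - scale (a h / 2) (coroot a)) + a (scale (a h / 2) (coroot a))"
      using dual_apply_add[OF roots_dual[OF a], of "h - scale (a h / 2) (coroot a)"
          "scale (a h / 2) (coroot a)"] mem coroot_span_subset_H coroot_mem_H[OF a]
        subspace_scale[OF subspace_H] by auto
    then show "a (h - scale (a h / 2) (coroot a)) = 0"
      using dual_apply_scale[OF roots_dual[OF a] coroot_mem_H[OF a]] root_coroot[OF a] by simp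
  qed
  then show ?thesis
    by simp
qed

lemma sl2_triple_exists:
  assumes a: "a \<in> roots" and e: "e \<in> root_space a" "e \<noteq> 0"
  shows "\<exists>f\<in>root_space (- a). bracket e f = coroot a"
proof -
  obtain B wt where "root_basis scale bracket H B wt"
    by (rule root_basis_locale_exists)
  then interpret root_basis scale bracket H B wt .
  obtain y where y: "y \<in> root_space (- a)" "bracket e y \<noteq> 0"
    using root_vector_bracket_nonzero[OF a e] by blast
  let ?c = "a (bracket e y) / 2"
  have ey: "bracket e y = scale ?c (coroot a)"
    by (rule coroot_span_eq_scale[OF a bracket_mem_coroot_span[OF e(1) y(1)]])
  then have "?c \<noteq> 0"
    using y(2) by (metis scale_zero_left)
  then have "bracket e (scale (inverse ?c) y) = coroot a"
    unfolding ad.act.scale by (subst ey) simp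
  then show ?thesis
    using y(1) subspace_scale[OF subspace_root_space] by blast
qed

lemma root_minus: "a \<in> roots \<Longrightarrow> - a \<in> roots"
proof -
  assume a: "a \<in> roots"
  then obtain e where e: "e \<in> root_space a" "e \<noteq> 0" by (rule rootsE)
  then obtain f where f: "f \<in> root_space (- a)" "bracket e f = coroot a"
    using sl2_triple_exists[OF a] by blast
  have "coroot a \<noteq> 0"
    using root_coroot[OF a] dual_apply_0[OF roots_dual[OF a]] by auto
  then have "f \<noteq> 0"
    using f(2) ad.act.zero by metis
  then show "- a \<in> roots"
    using f(1) roots_dual[OF a] roots_nonzero[OF a] by (intro rootsI) (auto intro: dual_closed)
qed

end

subsection \<open>Strings of weights\<close>

lemma (in cartan_module) funpow_act_wspace:
  assumes x: "x \<in> root_space c" and v: "v \<in> wspace b"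
  shows "(act x ^^ n) v \<in> wspace (b + fscale (of_nat n) c)"
proof (induction n)
  case 0
  have "b + fscale (of_nat 0) c = b"
    by (simp add: fun_eq_iff)
  then show ?case
    using v by simp
next
  case (Suc n)
  have eq: "b + fscale (of_nat (Suc n)) c = b + fscale (of_nat n) c + c"
    by (auto simp: fun_eq_iff algebra_simps)
  show ?case
    unfolding eq using act_root_space[OF x Suc] by (simp only: funpow.simps o_apply)
qed

text \<open>Otherwise the weights \<open>b + n c\<close> would be infinitely many.\<close>

lemma (in cartan_module) root_vector_nilpotent:
  assumes fin: "finite wts" and c: "c \<in> dual" "c \<noteq> 0" and x: "x \<in> root_space c"
    and v: "b \<in> dual" "v \<in> wspace b"
  shows "\<exists>n. (act x ^^ n) v = 0"
proof (rule ccontr)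
  assume none: "\<not> ?thesis"
  have mem: "(act x ^^ n) v \<in> wspace (b + fscale (of_nat n) c)" for n
    by (rule funpow_act_wspace[OF x v(2)])
  have "b + fscale (of_nat n) c \<in> wts" for n
    using none by (intro wtsI[OF _ mem]) (auto intro!: dual_closed c v)
  then have "range (\<lambda>n. b + fscale (of_nat n) c) \<subseteq> wts"
    by blast
  moreover have "inj (\<lambda>n::nat. b + fscale (of_nat n) c)"
  proof (rule injI)
    fix n n' :: nat
    assume eq: "b + fscale (of_nat n) c = b + fscale (of_nat n') c"
    obtain h where "c h \<noteq> 0"
      using c(2) by (auto simp: fun_eq_iff)
    then show "n = n'"
      using fun_cong[OF eq, of h] by simp
  qed
  ultimately show False
    using fin finite_subset finite_imageD infinite_UNIV_nat by metis
qed

text \<open>The weights of \<open>e\<close> and \<open>f\<close> together with \<open>a_2\<close>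
  encode the sl2 relations. They are symmetric under exchanging \<open>(a, e, f)\<close> with
  \<open>(- a, f, e)\<close>, which later covers weights with negative value on the coroot.\<close>

locale sl2_module = cartan_module scale bracket H scaleV act
  for scale :: "complex \<Rightarrow> 'g::ab_group_add \<Rightarrow> 'g"
    and bracket :: "'g \<Rightarrow> 'g \<Rightarrow> 'g"
    and H :: "'g set"
    and scaleV :: "complex \<Rightarrow> 'v::ab_group_add \<Rightarrow> 'v"
    and act :: "'g \<Rightarrow> 'v \<Rightarrow> 'v" +
  fixes a :: "'g \<Rightarrow> complex" and e f :: 'g
  assumes finite_weights: "finite wts"
    and a_dual: "a \<in> dual" and e: "e \<in> root_space a" and f: "f \<in> root_space (- a)"
    and a_2: "a (bracket e f) = 2"
begin

lemma h_mem_H: "bracket e f \<in> H"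
  by (rule bracket_opposite_mem_H[OF e f])

lemma a_nonzero: "a \<noteq> 0"
  using a_2 by auto

lemma pow_e_wspace: "v \<in> wspace b \<Longrightarrow> (act e ^^ n) v \<in> wspace (b + fscale (of_nat n) a)"
  by (rule funpow_act_wspace[OF e])

lemma pow_f_wspace: "v \<in> wspace b \<Longrightarrow> (act f ^^ n) v \<in> wspace (b - fscale (of_nat n) a)"
proof -
  have "b - fscale (of_nat n) a = b + fscale (of_nat n) (- a)"
    by (simp add: fun_eq_iff)
  then show "v \<in> wspace b \<Longrightarrow> ?thesis"
    using funpow_act_wspace[OF f, of v b n] by (simp only:)
qed

lemma act_e_pow_f:
  assumes u: "u \<in> wspace g" "act e u = 0"
  shows "act e ((act f ^^ Suc j) u)
    = scaleV (of_nat (Suc j) * (g (bracket e f) - of_nat j)) ((act f ^^ j) u)"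
proof (induction j)
  case 0
  have "act e (act f u) = act (bracket e f) u + act f (act e u)"
    by (simp add: act_bracket)
  then show ?case
    using u act_wspace[OF u(1) h_mem_H] by (simp add: act.zero)
next
  case (Suc j)
  let ?N = "g (bracket e f)" and ?w = "(act f ^^ Suc j) u"
  have "act e ((act f ^^ Suc (Suc j)) u) = act (bracket e f) ?w + act f (act e ?w)"
    by (simp add: act_bracket)
  also have "act (bracket e f) ?w = scaleV (?N - 2 * of_nat (Suc j)) ?w"
    using act_wspace[OF pow_f_wspace[OF u(1), of "Suc j"] h_mem_H]
    by (simp add: a_2 mult.commute)
  also have "act f (act e ?w) = scaleV (of_nat (Suc j) * (?N - of_nat j)) ?w"
    unfolding Suc.IH by (simp add: act.scale)
  also have "scaleV (?N - 2 * of_nat (Suc j)) ?w + \<dots>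
      = scaleV (of_nat (Suc (Suc j)) * (?N - of_nat (Suc j))) ?w"
    unfolding V.scale_left_distrib[symmetric]
    by (rule arg_cong[where f = "\<lambda>c. scaleV c ?w"]) (simp add: algebra_simps)
  finally show ?case .
qed

text \<open>At the first vanishing power \<open>f^(n+1) u = 0\<close>, \<open>act_e_pow_f\<close>
  leaves \<open>(n + 1) (g h - n) f^n u = 0\<close> with \<open>f^n u \<noteq> 0\<close>, where
  \<open>h = [e, f]\<close>.\<close>

lemma highest_weight_string:
  assumes u: "u \<in> wspace g" "g \<in> dual" "u \<noteq> 0" "act e u = 0"
  obtains n :: nat where "g (bracket e f) = of_nat n" "\<And>j. j \<le> n \<Longrightarrow> (act f ^^ j) u \<noteq> 0"
proof -
  have ex: "\<exists>k. (act f ^^ k) u = 0"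
    by (rule root_vector_nilpotent[OF finite_weights _ _ f u(2,1)])
      (use a_dual a_nonzero dual_minus in auto)
  define k where "k = (LEAST k. (act f ^^ k) u = 0)"
  have k: "(act f ^^ k) u = 0"
    unfolding k_def using ex by (rule LeastI_ex)
  have below: "(act f ^^ j) u \<noteq> 0" if "j < k" for j
    using that unfolding k_def by (rule not_less_Least)
  obtain n where n: "k = Suc n"
    using k u(3) by (cases k) auto
  have "scaleV (of_nat (Suc n) * (g (bracket e f) - of_nat n)) ((act f ^^ n) u) = 0"
    using act_e_pow_f[OF u(1,4), of n] k unfolding n by (simp add: act.zero)
  then have "of_nat (Suc n) * (g (bracket e f) - of_nat n) = 0"
    using below[of n] n by auto
  then have "g (bracket e f) = of_nat n"
    by (simp del: of_nat_Suc)
  then show ?thesis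
    using below n by (intro that) auto
qed

text \<open>Raising a weight vector as far as possible gives \<open>u = e^p v\<close> of weight
  \<open>b + p a\<close>, annihilated by \<open>e\<close>; lowering \<open>u\<close> produces the
  listed weights, with \<open>n = b h + 2 p\<close> for \<open>h = [e, f]\<close>.\<close>

lemma weight_string:
  assumes b: "b \<in> wts"
  shows "\<exists>n p::nat. b (bracket e f) = of_nat n - 2 * of_nat p
    \<and> (\<forall>j\<le>n. b + fscale (of_nat p - of_nat j) a \<in> wts)"
proof -
  have b_dual: "b \<in> dual"
    using b by (simp add: wts_def)
  obtain v where v: "v \<in> wspace b" "v \<noteq> 0"
    using b by (rule wtsE)
  have ex: "\<exists>k. (act e ^^ k) v = 0"
    by (rule root_vector_nilpotent[OF finite_weights a_dual a_nonzero e b_dual v(1)])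
  define k where "k = (LEAST k. (act e ^^ k) v = 0)"
  have k: "(act e ^^ k) v = 0"
    unfolding k_def using ex by (rule LeastI_ex)
  have below: "(act e ^^ j) v \<noteq> 0" if "j < k" for j
    using that unfolding k_def by (rule not_less_Least)
  obtain p where p: "k = Suc p"
    using k v(2) by (cases k) auto
  define u where "u = (act e ^^ p) v"
  let ?g = "b + fscale (of_nat p) a"
  have u: "u \<in> wspace ?g" "u \<noteq> 0" "act e u = 0"
    using pow_e_wspace[OF v(1)] below[of p] k p by (auto simp: u_def)
  have g_dual: "?g \<in> dual"
    using b_dual a_dual by (intro dual_closed)
  obtain n :: nat where n: "?g (bracket e f) = of_nat n"
      "\<And>j. j \<le> n \<Longrightarrow> (act f ^^ j) u \<noteq> 0"
    using highest_weight_string[OF u(1) g_dual u(2,3)] by metis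
  have "b (bracket e f) = of_nat n - 2 * of_nat p"
    using n(1) by (simp add: a_2 algebra_simps)
  moreover have "b + fscale (of_nat p - of_nat j) a \<in> wts" if "j \<le> n" for j
  proof -
    have "?g - fscale (of_nat j) a = b + fscale (of_nat p - of_nat j) a"
      by (auto simp: fun_eq_iff algebra_simps)
    moreover have "?g - fscale (of_nat j) a \<in> wts"
      using n(2)[OF that] pow_f_wspace[OF u(1)] g_dual a_dual
      by (intro wtsI) (auto intro: dual_closed)
    ultimately show ?thesis
      by (simp only:)
  qed
  ultimately show ?thesis
    by blast
qed

text \<open>The target is the entry \<open>j = n - p\<close> of the string. Nonnegativity gives
  \<open>2 p \<le> n\<close>, so this subtraction of naturals is exact.\<close>

lemma reflected_weight:
  assumes "b \<in> wts" "0 \<le> Re (b (bracket e f))"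
  shows "b - fscale (b (bracket e f)) a \<in> wts"
proof -
  obtain n p :: nat where np: "b (bracket e f) = of_nat n - 2 * of_nat p"
    and wts: "\<And>j. j \<le> n \<Longrightarrow> b + fscale (of_nat p - of_nat j) a \<in> wts"
    using weight_string[OF assms(1)] by blast
  have "2 * real p \<le> real n"
    using assms(2) np by simp
  then have le: "2 * p \<le> n"
    by linarith
  have "b + fscale (of_nat p - of_nat (n - p)) a = b - fscale (b (bracket e f)) a"
    unfolding np using le by (auto simp: fun_eq_iff of_nat_diff algebra_simps)
  then show ?thesis
    using wts[of "n - p"] by simp
qed

end

context cartan_module
begin

text \<open>The triple \<open>(a, e, f)\<close> handles weights of nonnegative value on the coroot,
  \<open>(- a, f, e)\<close> the others; both describe the same reflection.\<close>

lemma weight_reflection: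
  assumes fin: "finite wts" and a: "a \<in> roots" and b: "b \<in> wts"
  shows "b (coroot a) \<in> \<int>" and "reflection a b \<in> wts"
proof -
  obtain e where e: "e \<in> root_space a" "e \<noteq> 0"
    using a by (rule rootsE)
  then obtain f where f: "f \<in> root_space (- a)" "bracket e f = coroot a"
    using sl2_triple_exists[OF a] by blast
  interpret sl2: sl2_module scale bracket H scaleV act a e f
    using fin a e f root_coroot[OF a] by unfold_locales (auto simp: roots_dual)
  interpret op: sl2_module scale bracket H scaleV act "- a" f e
  proof unfold_locales
    have "bracket f e = scale (- 1) (coroot a)"
      using f(2) bracket_anticommute[of f e] by simp
    then show "(- a) (bracket f e) = 2"
      using dual_apply_scale[OF roots_dual[OF a] coroot_mem_H[OF a], of "- 1"] root_coroot[OF a]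
      by simp
  qed (use fin a e f dual_minus roots_dual in auto)
  obtain n p :: nat where np: "b (coroot a) = of_nat n - 2 * of_nat p"
    using sl2.weight_string[OF b] f(2) by auto
  then have "b (coroot a) = of_int (int n - 2 * int p)"
    by simp
  then show "b (coroot a) \<in> \<int>"
    using Ints_of_int by metis
  have b_dual: "b \<in> dual"
    using b by (simp add: wts_def)
  have fe: "b (bracket f e) = - b (coroot a)"
    using f(2) bracket_anticommute[of f e]
      dual_apply_scale[OF b_dual coroot_mem_H[OF a], of "- 1"] by simp
  show "reflection a b \<in> wts"
  proof (cases "0 \<le> Re (b (coroot a))")
    case True
    then show ?thesis
      using sl2.reflected_weight[OF b] f(2) by (simp add: reflection_def)
  next
    case False
    then have "b - fscale (b (bracket f e)) (- a) \<in> wts"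
      using op.reflected_weight[OF b] fe by simp
    also have "b - fscale (b (bracket f e)) (- a) = reflection a b"
      unfolding fe reflection_def by (auto simp: fun_eq_iff)
    finally show ?thesis .
  qed
qed

end

section \<open>Roots under reflections and the Weyl group\<close>

context simple_lie_algebra_cartan
begin

lemma root_ad_wt: "a \<in> roots \<Longrightarrow> a \<in> ad.wts"
  by (simp add: roots_eq_ad_wts)

lemma root_coroot_int: "\<lbrakk>a \<in> roots; b \<in> roots\<rbrakk> \<Longrightarrow> b (coroot a) \<in> \<int>"
  using ad.weight_reflection(1)[OF finite_ad_wts _ root_ad_wt] .

lemma reflection_reflection:
  assumes "a \<in> roots" shows "reflection a (reflection a b) = b"
proof
  fix x
  have "reflection a (reflection a b) x
      = (b x - b (coroot a) * a x) - (b (coroot a) - b (coroot a) * a (coroot a)) * a x"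
    by (simp add: reflection_def)
  also have "\<dots> = b x"
    by (simp add: root_coroot[OF assms])
  finally show "reflection a (reflection a b) x = b x" .
qed

lemma reflection_dual: "\<lbrakk>a \<in> roots; b \<in> dual\<rbrakk> \<Longrightarrow> reflection a b \<in> dual"
  unfolding reflection_def by (blast intro: dual_closed roots_dual)

lemma reflection_root: "\<lbrakk>a \<in> roots; b \<in> roots\<rbrakk> \<Longrightarrow> reflection a b \<in> roots"
proof -
  assume a: "a \<in> roots" and b: "b \<in> roots"
  have "reflection a b \<noteq> 0"
  proof
    assume "reflection a b = 0"
    moreover have "reflection a 0 = 0"
      by (simp add: reflection_def fun_eq_iff)
    ultimately have "b = 0"
      using reflection_reflection[OF a, of b] by simp
    then show False
      using roots_nonzero[OF b] by simp
  qed
  moreover have "reflection a b \<in> ad.wts"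
    using ad.weight_reflection(2)[OF finite_ad_wts a root_ad_wt[OF b]] .
  ultimately show "reflection a b \<in> roots"
    by (simp add: roots_eq_ad_wts)
qed

lemma weyl_root: "\<lbrakk>w \<in> weyl_group; a \<in> roots\<rbrakk> \<Longrightarrow> w a \<in> roots"
  by (induction rule: weyl_group.induct) (auto intro: reflection_root)

text \<open>Let \<open>n \<ge> 2\<close> be maximal with \<open>n a\<close> a root and
  \<open>x\<close> a nonzero vector of that weight. Then \<open>y = f^(n-1) x\<close> has weight
  \<open>a\<close>, so \<open>[f, y]\<close> is a multiple of the coroot, and applying
  \<open>e\<close> shows that \<open>y\<close> is a multiple of \<open>e\<close>. Hence
  \<open>[e, y] = 0\<close>, while the sl2 formula makes it a nonzero multiple of
  \<open>f^(n-2) x \<noteq> 0\<close>.\<close>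

lemma double_root_not_root:
  assumes a: "a \<in> roots"
  shows "fscale 2 a \<notin> roots"
proof
  assume two: "fscale 2 a \<in> roots"
  let ?M = "{n::nat. fscale (of_nat n) a \<in> roots}"
  have "inj_on (\<lambda>n::nat. fscale (of_nat n) a) ?M"
  proof (rule inj_onI)
    fix n n' :: nat
    assume eq: "fscale (of_nat n) a = fscale (of_nat n') a"
    show "n = n'"
      using fun_cong[OF eq, of "coroot a"] root_coroot[OF a] by simp
  qed
  then have fin: "finite ?M"
    by (rule inj_on_finite[OF _ _ finite_roots]) auto
  define n where "n = Max ?M"
  have "2 \<in> ?M"
    using two by simp
  then have n: "fscale (of_nat n) a \<in> roots" and n2: "2 \<le> n"
    using Max_in[OF fin] Max_ge[OF fin, of 2] unfolding n_def by blast+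
  have Suc_n: "fscale (of_nat (Suc n)) a \<notin> roots"
    using Max_ge[OF fin, of "Suc n"] by (auto simp: n_def)
  obtain e where e: "e \<in> root_space a" "e \<noteq> 0"
    using a by (rule rootsE)
  then obtain f where f: "f \<in> root_space (- a)" "bracket e f = coroot a"
    using sl2_triple_exists[OF a] by blast
  interpret sl2: sl2_module scale bracket H scale bracket a e f
    using finite_ad_wts a e f root_coroot[OF a] by unfold_locales (auto simp: roots_dual)
  obtain x where x: "x \<in> root_space (fscale (of_nat n) a)" "x \<noteq> 0"
    using n by (rule rootsE)
  have "fscale (of_nat n) a + a = fscale (of_nat (Suc n)) a"
    by (auto simp: fun_eq_iff algebra_simps)
  moreover have "fscale (of_nat (Suc n)) a \<noteq> 0"
    using root_coroot[OF a] by (auto simp: fun_eq_iff simp del: of_nat_Suc intro!: exI[of _ "coroot a"])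
  ultimately have ex: "bracket e x = 0"
    using bracket_root_spaces[OF e(1) x(1)] Suc_n roots_dual[OF a]
      root_space_trivial[of "fscale (of_nat (Suc n)) a"] by (auto intro: dual_fscale)
  note x' = x(1)[unfolded root_space_eq_wspace]
  obtain N :: nat where N: "fscale (of_nat n) a (bracket e f) = of_nat N"
    and nz: "\<And>j. j \<le> N \<Longrightarrow> (bracket f ^^ j) x \<noteq> 0"
    using sl2.highest_weight_string[OF x' _ x(2) ex] roots_dual[OF n] by metis
  have "of_nat N = (of_nat (2 * n) :: complex)"
    using N f(2) root_coroot[OF a] by (simp add: mult.commute)
  then have N: "N = 2 * n" "fscale (of_nat n) a (bracket e f) = of_nat (2 * n)"
    using N by (simp_all only: of_nat_eq_iff)
  \<comment> \<open>\<open>Suc m\<close> and \<open>m\<close> stand for \<open>n - 1\<close> and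
    \<open>n - 2\<close>.\<close>
  obtain m where m: "n = Suc (Suc m)"
    using n2 by (metis add_2_eq_Suc le_Suc_ex)
  define y where "y = (bracket f ^^ Suc m) x"
  have "fscale (of_nat n) a - fscale (of_nat (Suc m)) a = a"
    by (simp add: m fun_eq_iff algebra_simps)
  then have y: "y \<in> root_space a"
    using sl2.pow_f_wspace[OF x', of "Suc m"] by (simp add: y_def root_space_eq_wspace)
  have "bracket f y = - bracket y f"
    by (rule bracket_anticommute)
  moreover have "- bracket y f \<in> coroot_span a"
    using bracket_mem_coroot_span[OF y f(1)] by (simp add: coroot_span_def span_neg)
  ultimately obtain c where fy: "bracket f y = scale c (coroot a)"
    using coroot_span_eq_scale[OF a] by metis
  \<comment> \<open>This is \<open>e f^n x\<close>; the coefficient equals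
    \<open>n (n + 1)\<close>.\<close>
  have "bracket e (bracket f y)
      = scale (of_nat n * (of_nat (2 * n) - of_nat (Suc m))) y"
    using sl2.act_e_pow_f[OF x' ex, of "Suc m"] N(2) by (simp add: y_def m)
  moreover have "bracket e (bracket f y) = scale (- 2 * c) e"
    using bracket_anticommute[of e "coroot a"] bracket_root_space[OF e(1) coroot_mem_H[OF a]]
      root_coroot[OF a] by (simp add: fy ad.act.scale)
  moreover define r :: complex where "r = of_nat n * (of_nat (2 * n) - of_nat (Suc m))"
  ultimately have ry: "scale r y = scale (- 2 * c) e"
    by simp
  have "r = of_nat (n * (2 * n - Suc m))"
    by (simp add: r_def m of_nat_diff algebra_simps)
  moreover have "n * (2 * n - Suc m) \<noteq> 0"
    using m by simp
  ultimately have "r \<noteq> 0"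
    by (simp only: of_nat_eq_0_iff not_False_eq_True)
  have "scale r (bracket e y) = scale (- 2 * c) (bracket e e)"
    using arg_cong[OF ry, of "bracket e"] by (simp only: ad.act.scale)
  then have "bracket e y = 0"
    using \<open>r \<noteq> 0\<close> bracket_self by simp
  moreover have "bracket e y
      = scale (of_nat (Suc m) * (of_nat (2 * n) - of_nat m)) ((bracket f ^^ m) x)"
    unfolding y_def using sl2.act_e_pow_f[OF x' ex, of m] N(2) by simp
  moreover have "of_nat (Suc m) * (of_nat (2 * n) - of_nat m) = (of_nat (Suc m * (2 * n - m)) :: complex)"
    by (simp add: m of_nat_diff algebra_simps)
  moreover have "Suc m * (2 * n - m) \<noteq> 0"
    using m by simp
  then have "(of_nat (Suc m * (2 * n - m)) :: complex) \<noteq> 0"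
    by (simp only: of_nat_eq_0_iff not_False_eq_True)
  moreover have "(bracket f ^^ m) x \<noteq> 0"
    using nz N(1) m by simp
  ultimately show False
    by (metis scale_eq_0_iff)
qed

end

subsection \<open>Simple roots, coroots and the invariant form\<close>

lemma complex_of_nat_nonneg: "0 \<le> (of_nat n :: complex)"
  by (simp add: less_eq_complex_def)

context simple_lie_algebra_cartan
begin

lemma dual_apply_sum:
  assumes "f \<in> dual" "\<And>i. i \<in> I \<Longrightarrow> x i \<in> H"
  shows "f (\<Sum>i\<in>I. scale (c i) (x i)) = (\<Sum>i\<in>I. c i * f (x i))"
proof -
  from assms(2) have "(\<Sum>i\<in>I. scale (c i) (x i)) \<in> H
      \<and> f (\<Sum>i\<in>I. scale (c i) (x i)) = (\<Sum>i\<in>I. c i * f (x i))"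
  proof (induction I rule: infinite_finite_induct)
    case (insert i I)
    then show ?case
      using assms(1) subspace_H
      by (simp add: dual_apply_add dual_apply_scale subspace_add subspace_scale)
  qed (use assms(1) subspace_H in \<open>simp_all add: dual_apply_0 subspace_0\<close>)
  then show ?thesis ..
qed

lemma sum_fscale_apply: "(\<Sum>i\<in>I. fscale (c i) (v i)) x = (\<Sum>i\<in>I. c i * v i x)"
  by (induction I rule: infinite_finite_induct) auto

lemma nonneg_comb_add:
  assumes "nonneg_comb v f" "nonneg_comb v g"
  shows "nonneg_comb v (f + g)"
proof -
  obtain n n' :: "nat \<Rightarrow> nat" where "f = (\<Sum>i=1..rank. fscale (of_nat (n i)) (v i))"
      "g = (\<Sum>i=1..rank. fscale (of_nat (n' i)) (v i))"
    using assms by (auto simp: nonneg_comb_def)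
  then have "f + g = (\<Sum>i=1..rank. fscale (of_nat (n i + n' i)) (v i))"
    by (simp add: fun_eq_iff sum_fscale_apply sum.distrib algebra_simps)
  then show ?thesis
    unfolding nonneg_comb_def by (intro exI[of _ "\<lambda>i. n i + n' i"])
qed

lemma nonneg_comb_0: "nonneg_comb v 0"
  unfolding nonneg_comb_def
  by (rule exI[of _ "\<lambda>_. 0"]) (simp add: fun_eq_iff sum_fscale_apply)

end

context simple_lie_algebra_data
begin

lemma form_commute: "\<lbrakk>f \<in> dual; g \<in> dual\<rbrakk> \<Longrightarrow> form f g = form g f"
  and form_add_left: "\<lbrakk>f \<in> dual; g \<in> dual; h \<in> dual\<rbrakk> \<Longrightarrow> form (f + g) h = form f h + form g h"
  and form_scale_left: "\<lbrakk>f \<in> dual; g \<in> dual\<rbrakk> \<Longrightarrow> form (fscale c f) g = c * form f g"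
  and form_weyl: "\<lbrakk>w \<in> weyl_group; f \<in> dual; g \<in> dual\<rbrakk> \<Longrightarrow> form (w f) (w g) = form f g"
  using invariant_form unfolding invariant_form_def by blast+

lemma form_add_right: "\<lbrakk>f \<in> dual; g \<in> dual; h \<in> dual\<rbrakk> \<Longrightarrow> form h (f + g) = form h f + form h g"
  using form_add_left[of f g h] by (simp add: form_commute[of h] dual_add)

lemma form_scale_right: "\<lbrakk>f \<in> dual; g \<in> dual\<rbrakk> \<Longrightarrow> form g (fscale c f) = c * form g f"
  using form_scale_left[of f g c] by (simp add: form_commute[of g] dual_fscale)

lemma form_sum_left:
  assumes "g \<in> dual" "\<And>i. i \<in> I \<Longrightarrow> v i \<in> dual"
  shows "form (\<Sum>i\<in>I. fscale (c i) (v i)) g = (\<Sum>i\<in>I. c i * form (v i) g)"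
proof -
  have "form 0 g = 0"
    using form_scale_left[OF dual_0 assms(1), of 0] by (simp add: fscale_def flip: zero_fun_def)
  with assms show ?thesis
    by (induction I rule: infinite_finite_induct)
      (simp_all add: form_add_left form_scale_left dual_closed)
qed

lemma form_sum_right:
  assumes "g \<in> dual" "\<And>i. i \<in> I \<Longrightarrow> v i \<in> dual"
  shows "form g (\<Sum>i\<in>I. fscale (c i) (v i)) = (\<Sum>i\<in>I. c i * form g (v i))"
proof -
  have "form g (\<Sum>i\<in>I. fscale (c i) (v i)) = form (\<Sum>i\<in>I. fscale (c i) (v i)) g"
    using assms by (intro form_commute) (auto intro: dual_closed)
  also have "\<dots> = (\<Sum>i\<in>I. c i * form (v i) g)"
    using assms by (rule form_sum_left)
  also have "\<dots> = (\<Sum>i\<in>I. c i * form g (v i))"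
    using assms form_commute by (intro sum.cong) auto
  finally show ?thesis .
qed

lemma form_reflection:
  "\<lbrakk>a \<in> roots; f \<in> dual; g \<in> dual\<rbrakk> \<Longrightarrow> form (reflection a f) (reflection a g) = form f g"
  using form_weyl[OF weyl_group.refl[OF _ weyl_group.one]] by simp

text \<open>Invariance under \<open>reflection a\<close>, with \<open>reflection a a = - a\<close>,
  links the form to coroots. The equation is kept free of division because
  \<open>form a a \<noteq> 0\<close> is not known for an arbitrary root.\<close>

lemma form_root:
  assumes a: "a \<in> roots" and f: "f \<in> dual"
  shows "2 * form f a = f (coroot a) * form a a"
proof -
  have ad: "a \<in> dual"
    using a by (rule roots_dual)
  have refl_a: "reflection a a = fscale (- 1) a"
    using root_coroot[OF a] by (simp add: reflection_def fun_eq_iff)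
  have refl_f: "reflection a f = f + fscale (- f (coroot a)) a"
    by (simp add: reflection_def fun_eq_iff)
  have "form f a = form (f + fscale (- f (coroot a)) a) (fscale (- 1) a)"
    using form_reflection[OF a f ad] by (simp add: refl_a refl_f)
  also have "\<dots> = - (form f a - f (coroot a) * form a a)"
    using ad f by (simp add: form_scale_right form_scale_left form_add_left dual_closed)
  finally show ?thesis
    by simp
qed

lemma pairing_root:
  "\<lbrakk>a \<in> roots; f \<in> dual; form a a \<noteq> 0\<rbrakk> \<Longrightarrow> pairing form f a = f (coroot a)"
  using form_root[of a f] by (simp add: pairing_def)

lemma simple_root: "i \<in> {1..rank} \<Longrightarrow> \<alpha> i \<in> roots"
  and simple_roots_independent:
    "\<lbrakk>(\<Sum>i=1..rank. fscale (c i) (\<alpha> i)) = 0; i \<in> {1..rank}\<rbrakk> \<Longrightarrow> c i = 0"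
  and root_sign: "b \<in> roots \<Longrightarrow> nonneg_comb \<alpha> b \<or> nonneg_comb \<alpha> (- b)"
  using simple_roots unfolding simple_roots_def by blast+

lemma simple_dual: "i \<in> {1..rank} \<Longrightarrow> \<alpha> i \<in> dual"
  by (rule roots_dual[OF simple_root])

lemma simple_coeff_unique:
  assumes "(\<Sum>i=1..rank. fscale (c i) (\<alpha> i)) = (\<Sum>i=1..rank. fscale (d i) (\<alpha> i))"
    and i: "i \<in> {1..rank}"
  shows "c i = d i"
proof -
  have "(\<Sum>i=1..rank. fscale (c i - d i) (\<alpha> i)) = 0"
    using assms(1)
    by (simp add: fun_eq_iff sum_fscale_apply left_diff_distrib sum_subtractf)
  then show ?thesis
    using simple_roots_independent i by fastforce
qed

lemma fund_coroot:
  assumes i: "i \<in> {1..rank}" and j: "j \<in> {1..rank}"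
  shows "fund i (coroot (\<alpha> j)) = (if i = j then 1 else 0)"
proof -
  \<comment> \<open>A vanishing square length would make \<open>pairing\<close> a division by zero,
    with value 0 instead of 1.\<close>
  have "form (\<alpha> j) (\<alpha> j) \<noteq> 0"
    using fund_simple[OF j j] by (auto simp: pairing_def)
  then show ?thesis
    using pairing_root[OF simple_root[OF j] fund_dual[OF i]] fund_simple[OF i j] by simp
qed

text \<open>The fundamental weights are dual to the simple coroots, so these are independent, and
  there are \<open>rank = dim H\<close> of them.\<close>

lemma simple_coroots_span: "span ((\<lambda>i. coroot (\<alpha> i)) ` {1..rank}) = H"
proof -
  let ?S = "(\<lambda>i. coroot (\<alpha> i)) ` {1..rank}"
  have S_H: "?S \<subseteq> H"
    using coroot_mem_H simple_root by auto
  have inj: "inj_on (\<lambda>i. coroot (\<alpha> i)) {1..rank}"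
  proof (rule inj_onI)
    fix i j assume ij: "i \<in> {1..rank}" "j \<in> {1..rank}" and eq: "coroot (\<alpha> i) = coroot (\<alpha> j)"
    show "i = j"
      using fund_coroot[OF ij(1,1)] fund_coroot[OF ij] eq by (auto split: if_splits)
  qed
  have "independent ?S"
  proof (rule independent_if_scalars_zero)
    fix c s assume 0: "(\<Sum>s\<in>?S. scale (c s) s) = 0" and "s \<in> ?S"
    then obtain j where j: "j \<in> {1..rank}" "s = coroot (\<alpha> j)"
      by blast
    have "(\<Sum>i=1..rank. scale (c (coroot (\<alpha> i))) (coroot (\<alpha> i))) = 0"
      using 0 unfolding sum.reindex[OF inj] o_def .
    then have "fund j (\<Sum>i=1..rank. scale (c (coroot (\<alpha> i))) (coroot (\<alpha> i))) = 0"
      using dual_apply_0 fund_dual[OF j(1)] by simp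
    then have "(\<Sum>i=1..rank. c (coroot (\<alpha> i)) * fund j (coroot (\<alpha> i))) = 0"
      using S_H by (subst (asm) dual_apply_sum[OF fund_dual[OF j(1)]]) auto
    also have "(\<Sum>i=1..rank. c (coroot (\<alpha> i)) * fund j (coroot (\<alpha> i)))
        = (\<Sum>i=1..rank. if j = i then c (coroot (\<alpha> i)) else 0)"
      by (rule sum.cong[OF HOL.refl]) (simp add: fund_coroot j del: One_nat_def atLeastAtMost_iff)
    finally show "c s = 0"
      using j by simp
  qed simp
  moreover obtain F where F: "finite F" "independent F" "span F = UNIV"
    using finite_basis_subset[OF subspace_UNIV] by metis
  then interpret fd: finite_dimensional_vector_space scale F
    by unfold_locales
  have "dim H \<le> card ?S"
    using card_image[OF inj] by (simp add: rank_def)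
  ultimately have "H \<subseteq> span ?S"
    using fd.card_ge_dim_independent[OF S_H] by blast
  then show ?thesis
    using span_minimal[OF S_H subspace_H] by blast
qed

lemma dual_eq_on_coroots:
  assumes f: "f \<in> dual" and g: "g \<in> dual"
    and eq: "\<And>j. j \<in> {1..rank} \<Longrightarrow> f (coroot (\<alpha> j)) = g (coroot (\<alpha> j))"
  shows "f = g"
proof (rule dual_eqI[OF f g])
  fix h assume "h \<in> H"
  then have "h \<in> span ((\<lambda>i. coroot (\<alpha> i)) ` {1..rank})"
    unfolding simple_coroots_span .
  then have "h \<in> H \<and> f h = g h"
  proof (induction rule: span_induct_alt)
    case base
    then show ?case
      using subspace_0[OF subspace_H] by (simp add: dual_apply_0[OF f] dual_apply_0[OF g])
  next
    case (step c x y)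
    then have "x \<in> H" "f x = g x"
      using eq coroot_mem_H simple_root by auto
    then show ?case
      using step(2) f g subspace_H
      by (simp add: dual_apply_add dual_apply_scale subspace_add subspace_scale)
  qed
  then show "f h = g h" ..
qed

lemma fund_expansion:
  assumes f: "f \<in> dual"
  shows "f = (\<Sum>i=1..rank. fscale (f (coroot (\<alpha> i))) (fund i))"
proof (rule dual_eq_on_coroots[OF f])
  show "(\<Sum>i=1..rank. fscale (f (coroot (\<alpha> i))) (fund i)) \<in> dual"
    by (intro dual_closed fund_dual)
  fix j assume j: "j \<in> {1..rank}"
  have "(\<Sum>i=1..rank. fscale (f (coroot (\<alpha> i))) (fund i)) (coroot (\<alpha> j))
      = (\<Sum>i=1..rank. if i = j then f (coroot (\<alpha> i)) else 0)"
    unfolding sum_fscale_apply by (rule sum.cong[OF HOL.refl]) (simp add: fund_coroot j del: One_nat_def atLeastAtMost_iff)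
  then show "f (coroot (\<alpha> j)) = (\<Sum>i=1..rank. fscale (f (coroot (\<alpha> i))) (fund i)) (coroot (\<alpha> j))"
    using j by simp
qed

section \<open>Coefficients and coroot values of the highest root\<close>

lemma theta_root: "\<theta> \<in> roots"
  and theta_highest: "b \<in> roots \<Longrightarrow> nonneg_comb \<alpha> (\<theta> - b)"
  using highest_root by (auto simp: highest_root_def)

lemma theta_dual: "\<theta> \<in> dual"
  by (rule roots_dual[OF theta_root])

text \<open>Subtracting a multiple of a simple root, as simple reflections do, changes one
  coefficient only; independence allows it to be read off.\<close>

lemma simple_sub_coeff:
  assumes eq: "(\<Sum>k=1..rank. fscale (c k) (\<alpha> k)) - fscale z (\<alpha> i)
      = (\<Sum>k=1..rank. fscale (d k) (\<alpha> k))"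
    and i: "i \<in> {1..rank}" and j: "j \<in> {1..rank}"
  shows "d j = (if j = i then c j - z else c j)"
proof -
  have "(\<Sum>k=1..rank. fscale (c k) (\<alpha> k)) - fscale z (\<alpha> i)
      = (\<Sum>k=1..rank. fscale (if k = i then c k - z else c k) (\<alpha> k))"
  proof
    fix x
    have "(\<Sum>k=1..rank. (if k = i then c k - z else c k) * \<alpha> k x)
        = (\<Sum>k=1..rank. c k * \<alpha> k x - (if k = i then z * \<alpha> k x else 0))"
      by (rule sum.cong) (auto simp: left_diff_distrib)
    also have "\<dots> = (\<Sum>k=1..rank. c k * \<alpha> k x) - z * \<alpha> i x"
      using i by (simp add: sum_subtractf)
    finally show "((\<Sum>k=1..rank. fscale (c k) (\<alpha> k)) - fscale z (\<alpha> i)) x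
        = (\<Sum>k=1..rank. fscale (if k = i then c k - z else c k) (\<alpha> k)) x"
      by (simp add: sum_fscale_apply)
  qed
  then have "(\<Sum>k=1..rank. fscale (if k = i then c k - z else c k) (\<alpha> k))
      = (\<Sum>k=1..rank. fscale (d k) (\<alpha> k))"
    using eq by (rule trans[OF sym])
  from simple_coeff_unique[OF this j] show ?thesis
    by (rule sym)
qed

text \<open>If \<open>- \<theta>\<close> were a nonnegative combination, then
  \<open>0 = (\<theta> - (- \<theta>)) + 2 (- \<theta>)\<close> would be one with coefficients
  \<open>m + 2 n\<close>, forcing \<open>\<theta> = 0\<close>. The bound by 1 then comes from
  \<open>\<theta> - \<alpha> i\<close>.\<close>

lemma theta_coeffs:
  obtains c :: "nat \<Rightarrow> nat" where "\<theta> = (\<Sum>i=1..rank. fscale (of_nat (c i)) (\<alpha> i))"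
    and "\<And>i. i \<in> {1..rank} \<Longrightarrow> 1 \<le> c i"
proof -
  have "nonneg_comb \<alpha> \<theta>"
  proof (rule ccontr)
    assume "\<not> nonneg_comb \<alpha> \<theta>"
    then obtain n where n: "- \<theta> = (\<Sum>i=1..rank. fscale (of_nat (n i)) (\<alpha> i))"
      using root_sign[OF theta_root] by (auto simp: nonneg_comb_def)
    obtain m where m: "\<theta> - (- \<theta>) = (\<Sum>i=1..rank. fscale (of_nat (m i)) (\<alpha> i))"
      using theta_highest[OF root_minus[OF theta_root]] by (auto simp: nonneg_comb_def)
    have 0: "(\<Sum>i=1..rank. fscale (of_nat (2 * n i + m i)) (\<alpha> i)) = 0"
    proof
      fix x
      have "(\<Sum>i=1..rank. of_nat (2 * n i + m i) * \<alpha> i x)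
          = 2 * (\<Sum>i=1..rank. of_nat (n i) * \<alpha> i x) + (\<Sum>i=1..rank. of_nat (m i) * \<alpha> i x)"
        by (simp add: algebra_simps sum.distrib sum_distrib_left)
      also have "\<dots> = 2 * (- \<theta>) x + (\<theta> - (- \<theta>)) x"
        using fun_cong[OF n, of x] fun_cong[OF m, of x] by (simp only: sum_fscale_apply)
      finally show "(\<Sum>i=1..rank. fscale (of_nat (2 * n i + m i)) (\<alpha> i)) x = 0 x"
        by (simp add: sum_fscale_apply)
    qed
    have "n i = 0" if "i \<in> {1..rank}" for i
    proof -
      have "(of_nat (2 * n i + m i) :: complex) = 0"
        using simple_roots_independent[OF 0 that] .
      then show ?thesis
        by (simp only: of_nat_eq_0_iff)
    qed
    then have "- \<theta> = 0"
      unfolding n by (simp add: fun_eq_iff sum_fscale_apply)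
    then show False
      using roots_nonzero[OF theta_root] by simp
  qed
  then obtain c where c: "\<theta> = (\<Sum>i=1..rank. fscale (of_nat (c i)) (\<alpha> i))"
    by (auto simp: nonneg_comb_def)
  have "1 \<le> c i" if i: "i \<in> {1..rank}" for i
  proof -
    obtain d where d: "\<theta> - \<alpha> i = (\<Sum>i=1..rank. fscale (of_nat (d i)) (\<alpha> i))"
      using theta_highest[OF simple_root[OF i]] by (auto simp: nonneg_comb_def)
    have "\<theta> - fscale 1 (\<alpha> i) = (\<Sum>i=1..rank. fscale (of_nat (d i)) (\<alpha> i))"
      unfolding d[symmetric] by (simp add: fun_eq_iff)
    then have "(of_nat (d i) :: complex) = of_nat (c i) - 1"
      using simple_sub_coeff[of "\<lambda>i. of_nat (c i)" 1 i "\<lambda>i. of_nat (d i)" i] i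
      unfolding c by simp
    then have "(of_nat (d i + 1) :: complex) = of_nat (c i)"
      by simp
    then have "d i + 1 = c i"
      by (simp only: of_nat_eq_iff)
    then show ?thesis by simp
  qed
  then show ?thesis
    using that c by blast
qed

text \<open>\<open>\<theta>\<close> also lies above \<open>reflection \<theta> (\<alpha> i)\<close>.
  The difference is \<open>(1 + z) \<theta> - \<alpha> i\<close>, whose coefficient
  \<open>(1 + z) c i - 1\<close> at \<open>\<alpha> i\<close> is nonnegative; with
  \<open>c i \<ge> 1\<close> this forces \<open>z \<ge> 0\<close>.\<close>

lemma simple_coroot_theta_nonneg:
  assumes i: "i \<in> {1..rank}"
  obtains n :: nat where "\<alpha> i (coroot \<theta>) = of_nat n"
proof -
  obtain z where z: "\<alpha> i (coroot \<theta>) = of_int z"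
    using root_coroot_int[OF theta_root simple_root[OF i]] by (auto elim: Ints_cases)
  obtain c :: "nat \<Rightarrow> nat" where c: "\<theta> = (\<Sum>i=1..rank. fscale (of_nat (c i)) (\<alpha> i))"
    and c1: "\<And>i. i \<in> {1..rank} \<Longrightarrow> 1 \<le> c i"
    using theta_coeffs by metis
  obtain d where d: "\<theta> - reflection \<theta> (\<alpha> i) = (\<Sum>i=1..rank. fscale (of_nat (d i)) (\<alpha> i))"
    using theta_highest[OF reflection_root[OF theta_root simple_root[OF i]]]
    by (auto simp: nonneg_comb_def)
  have "\<theta> - reflection \<theta> (\<alpha> i)
      = (\<Sum>k=1..rank. fscale ((1 + of_int z) * of_nat (c k)) (\<alpha> k)) - fscale 1 (\<alpha> i)"
  proof
    fix x
    have "(\<Sum>k=1..rank. (1 + of_int z) * of_nat (c k) * \<alpha> k x) = (1 + of_int z) * \<theta> x"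
      by (simp add: c sum_fscale_apply sum_distrib_left mult.assoc)
    then show "(\<theta> - reflection \<theta> (\<alpha> i)) x
        = ((\<Sum>k=1..rank. fscale ((1 + of_int z) * of_nat (c k)) (\<alpha> k)) - fscale 1 (\<alpha> i)) x"
      by (simp add: sum_fscale_apply reflection_def z algebra_simps)
  qed
  then have "(of_nat (d i) :: complex) = (1 + of_int z) * of_nat (c i) - 1"
    using simple_sub_coeff[of "\<lambda>k. (1 + of_int z) * of_nat (c k)" 1 i "\<lambda>i. of_nat (d i)" i] i d
    by simp
  then have "(of_int (int (d i)) :: complex) = of_int ((1 + z) * int (c i) - 1)"
    by simp
  then have "int (d i) = (1 + z) * int (c i) - 1"
    by (simp only: of_int_eq_iff)
  then have "0 < (1 + z) * int (c i)"
    by linarith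
  then have "0 \<le> z"
    using c1[OF i] by (simp add: zero_less_mult_iff)
  then show ?thesis
    using that[of "nat z"] z by simp
qed

text \<open>Here \<open>\<theta> - reflection (\<alpha> i) \<theta>\<close> is \<open>z\<close>
  times \<open>\<alpha> i\<close>. The sign cannot be transferred from the previous lemma through
  the form, since the sign of \<open>(\<alpha> i, \<alpha> i)\<close> is still open.\<close>

lemma theta_simple_coroot_nonneg:
  assumes i: "i \<in> {1..rank}"
  obtains n :: nat where "\<theta> (coroot (\<alpha> i)) = of_nat n"
proof -
  obtain z where z: "\<theta> (coroot (\<alpha> i)) = of_int z"
    using root_coroot_int[OF simple_root[OF i] theta_root] by (auto elim: Ints_cases)
  obtain d where d: "\<theta> - reflection (\<alpha> i) \<theta> = (\<Sum>i=1..rank. fscale (of_nat (d i)) (\<alpha> i))"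
    using theta_highest[OF reflection_root[OF simple_root[OF i] theta_root]]
    by (auto simp: nonneg_comb_def)
  have "\<theta> - reflection (\<alpha> i) \<theta> = (\<Sum>k=1..rank. fscale 0 (\<alpha> k)) - fscale (- of_int z) (\<alpha> i)"
    by (simp add: fun_eq_iff sum_fscale_apply reflection_def z)
  then have "(of_nat (d i) :: complex) = of_int z"
    using simple_sub_coeff[of "\<lambda>k. 0" "- of_int z" i "\<lambda>i. of_nat (d i)" i] i d by simp
  then show ?thesis
    using that[of "d i"] z by simp
qed

text \<open>The root \<open>reflection (\<alpha> j) (\<alpha> i) = \<alpha> i - z \<alpha> j\<close>
  has coefficient 1 at \<open>\<alpha> i\<close>, hence is positive, and so
  \<open>- z \<ge> 0\<close>.\<close>

lemma simple_simple_coroot_nonpos: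
  assumes i: "i \<in> {1..rank}" and j: "j \<in> {1..rank}" and "i \<noteq> j"
  obtains n :: nat where "\<alpha> i (coroot (\<alpha> j)) = - of_nat n"
proof -
  obtain z where z: "\<alpha> i (coroot (\<alpha> j)) = of_int z"
    using root_coroot_int[OF simple_root[OF j] simple_root[OF i]] by (auto elim: Ints_cases)
  let ?c = "\<lambda>k. if k = i then 1 else 0 :: complex"
  have alpha: "(\<Sum>k=1..rank. fscale (?c k) (\<alpha> k)) = \<alpha> i"
  proof
    fix x
    have "(\<Sum>k=1..rank. ?c k * \<alpha> k x) = (\<Sum>k=1..rank. if k = i then \<alpha> k x else 0)"
      by (rule sum.cong) auto
    then show "(\<Sum>k=1..rank. fscale (?c k) (\<alpha> k)) x = \<alpha> i x"
      using i by (simp add: sum_fscale_apply)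
  qed
  have refl: "reflection (\<alpha> j) (\<alpha> i)
      = (\<Sum>k=1..rank. fscale (?c k) (\<alpha> k)) - fscale (of_int z) (\<alpha> j)"
    unfolding alpha reflection_def z ..
  have coeff: "d j = - of_int z" "d i = 1"
    if "reflection (\<alpha> j) (\<alpha> i) = (\<Sum>i=1..rank. fscale (d i) (\<alpha> i))" for d
    using simple_sub_coeff[OF _ j j, of ?c "of_int z" d] simple_sub_coeff[OF _ j i, of ?c "of_int z" d]
      that refl \<open>i \<noteq> j\<close> by auto
  from root_sign[OF reflection_root[OF simple_root[OF j] simple_root[OF i]]] show ?thesis
  proof
    assume "nonneg_comb \<alpha> (reflection (\<alpha> j) (\<alpha> i))"
    then obtain d where "reflection (\<alpha> j) (\<alpha> i) = (\<Sum>i=1..rank. fscale (of_nat (d i)) (\<alpha> i))"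
      by (auto simp: nonneg_comb_def)
    then have "of_nat (d j) = (- of_int z :: complex)"
      by (rule coeff)
    then show ?thesis
      using that[of "d j"] z by simp
  next
    assume "nonneg_comb \<alpha> (- reflection (\<alpha> j) (\<alpha> i))"
    then obtain d where "- reflection (\<alpha> j) (\<alpha> i) = (\<Sum>i=1..rank. fscale (of_nat (d i)) (\<alpha> i))"
      by (auto simp: nonneg_comb_def)
    then have "reflection (\<alpha> j) (\<alpha> i) = - (\<Sum>i=1..rank. fscale (of_nat (d i)) (\<alpha> i))"
      by (metis minus_minus)
    also have "\<dots> = (\<Sum>i=1..rank. fscale (- of_nat (d i)) (\<alpha> i))"
      by (simp add: fun_eq_iff sum_fscale_apply sum_negf)
    finally have "- of_nat (d i) = (1 :: complex)"
      by (rule coeff)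
    then have "1 + of_nat (d i) = (0 :: complex)"
      by (metis add.left_inverse)
    then have "of_nat (Suc (d i)) = (0 :: complex)"
      by simp
    then show ?thesis
      by (simp only: of_nat_eq_0_iff nat.distinct)
  qed
qed

subsection \<open>Lengths of simple roots and integrality\<close>

lemma form_simple_nonzero: "i \<in> {1..rank} \<Longrightarrow> form (\<alpha> i) (\<alpha> i) \<noteq> 0"
  using fund_simple[of i i] by (auto simp: pairing_def)

lemma form_root_theta: "f \<in> dual \<Longrightarrow> form f \<theta> = f (coroot \<theta>)"
  using form_root[OF theta_root] by (simp add: normalized)

lemma simple_form_symmetry:
  assumes i: "i \<in> {1..rank}" and j: "j \<in> {1..rank}"
  shows "\<alpha> i (coroot (\<alpha> j)) * form (\<alpha> j) (\<alpha> j) = \<alpha> j (coroot (\<alpha> i)) * form (\<alpha> i) (\<alpha> i)"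
  using form_root[OF simple_root[OF j] simple_dual[OF i]]
    form_root[OF simple_root[OF i] simple_dual[OF j]]
    form_commute[OF simple_dual[OF i] simple_dual[OF j]] by simp

text \<open>
  The set of simple roots of positive square length contains every \<open>\<alpha> j\<close> not orthogonal to
  \<open>\<theta>\<close> and is closed under adjacency in the Dynkin diagram.  The part of \<open>\<theta>\<close> supported on the
  remaining simple roots is then orthogonal to all simple coroots, hence zero; but \<open>\<theta>\<close> has full
  support.
\<close>
lemma form_simple_positive:
  assumes j: "j \<in> {1..rank}"
  shows "\<exists>r::real. 0 < r \<and> form (\<alpha> j) (\<alpha> j) = of_real r"
proof (rule ccontr)
  define P where "P i \<longleftrightarrow> (\<exists>r::real. 0 < r \<and> form (\<alpha> i) (\<alpha> i) = of_real r)" for i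
  assume "\<not> ?thesis"
  then have "\<not> P j"
    by (simp add: P_def)
  obtain c :: "nat \<Rightarrow> nat" where c: "\<theta> = (\<Sum>i=1..rank. fscale (of_nat (c i)) (\<alpha> i))"
    and c1: "\<And>i. i \<in> {1..rank} \<Longrightarrow> 1 \<le> c i"
    using theta_coeffs by metis
  have theta_adjacent: "P i" if i: "i \<in> {1..rank}" and nz: "\<theta> (coroot (\<alpha> i)) \<noteq> 0" for i
  proof -
    obtain n :: nat where n: "\<alpha> i (coroot \<theta>) = of_nat n"
      using simple_coroot_theta_nonneg[OF i] .
    obtain m :: nat where m: "\<theta> (coroot (\<alpha> i)) = of_nat m"
      using theta_simple_coroot_nonneg[OF i] .
    \<comment> \<open>Both sides are \<open>2 (\<theta>, \<alpha> i)\<close>, computed through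
      \<open>coroot (\<alpha> i)\<close> and through \<open>coroot \<theta>\<close>.\<close>
    have "of_nat m * form (\<alpha> i) (\<alpha> i) = 2 * of_nat n"
      using form_root[OF simple_root[OF i] theta_dual] form_root_theta[OF simple_dual[OF i]]
        form_commute[OF theta_dual simple_dual[OF i]] by (simp add: n m)
    then have eq: "form (\<alpha> i) (\<alpha> i) = of_real (2 * real n / real m)"
      using nz m by (simp add: field_simps)
    moreover have "n \<noteq> 0"
      using eq form_simple_nonzero[OF i] by auto
    ultimately show ?thesis
      unfolding P_def using nz m by (intro exI[of _ "2 * real n / real m"]) auto
  qed
  have adjacent: "P i"
    if i: "i \<in> {1..rank}" and k: "k \<in> {1..rank}" and "P k" and nz: "\<alpha> i (coroot (\<alpha> k)) \<noteq> 0" for i k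
  proof (cases "i = k")
    case False
    obtain n :: nat where n: "\<alpha> i (coroot (\<alpha> k)) = - of_nat n"
      using simple_simple_coroot_nonpos[OF i k False] .
    obtain m :: nat where m: "\<alpha> k (coroot (\<alpha> i)) = - of_nat m"
      using simple_simple_coroot_nonpos[OF k i] False by metis
    obtain r :: real where r: "0 < r" "form (\<alpha> k) (\<alpha> k) = of_real r"
      using \<open>P k\<close> by (auto simp: P_def)
    have eq: "of_nat n * of_real r = of_nat m * form (\<alpha> i) (\<alpha> i)"
      using simple_form_symmetry[OF i k] by (simp add: n m r)
    have "n \<noteq> 0"
      using nz n by auto
    moreover have "m \<noteq> 0"
      using eq r(1) \<open>n \<noteq> 0\<close> by (intro notI) simp
    moreover have "form (\<alpha> i) (\<alpha> i) = of_real (real n * r / real m)"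
      using eq \<open>m \<noteq> 0\<close> by (simp add: field_simps)
    ultimately show ?thesis
      unfolding P_def using r(1) by (intro exI[of _ "real n * r / real m"]) auto
  qed (use \<open>P k\<close> in simp)
  define g where "g = (\<Sum>i=1..rank. fscale (if P i then 0 else of_nat (c i)) (\<alpha> i))"
  have "g = 0"
  proof (rule dual_eq_on_coroots[OF _ dual_0])
    show "g \<in> dual"
      unfolding g_def by (intro dual_closed simple_dual)
    fix k assume k: "k \<in> {1..rank}"
    show "g (coroot (\<alpha> k)) = 0 (coroot (\<alpha> k))"
    proof (cases "P k")
      case True
      have "(if P i then 0 else of_nat (c i)) * \<alpha> i (coroot (\<alpha> k)) = 0" if "i \<in> {1..rank}" for i
        using adjacent[OF that k True] by auto
      then have "g (coroot (\<alpha> k)) = 0"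
        unfolding g_def sum_fscale_apply by (intro sum.neutral) blast
      then show ?thesis
        by simp
    next
      case False
      \<comment> \<open>For \<open>k\<close> outside \<open>P\<close>, the simple roots in
        \<open>P\<close> vanish on \<open>coroot (\<alpha> k)\<close>, so dropping them from
        \<open>\<theta>\<close> does not change its value there, and that value is 0 by
        \<open>theta_adjacent\<close>.\<close>
      have "(if P i then 0 else of_nat (c i)) * \<alpha> i (coroot (\<alpha> k))
          = of_nat (c i) * \<alpha> i (coroot (\<alpha> k))" if i: "i \<in> {1..rank}" for i
      proof (cases "P i")
        case True
        have "\<alpha> k (coroot (\<alpha> i)) = 0"
          using adjacent[OF k i True] False by blast
        then have "\<alpha> i (coroot (\<alpha> k)) = 0"
          using simple_form_symmetry[OF i k] form_simple_nonzero[OF k] by simp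
        then show ?thesis
          by simp
      qed simp
      then have "g (coroot (\<alpha> k)) = \<theta> (coroot (\<alpha> k))"
        unfolding g_def c sum_fscale_apply by (intro sum.cong) auto
      then show ?thesis
        using theta_adjacent[OF k] False by auto
    qed
  qed
  then have "(if P j then 0 else of_nat (c j) :: complex) = 0"
    unfolding g_def by (rule simple_roots_independent[OF _ j])
  then show False
    using \<open>\<not> P j\<close> c1[OF j] by simp
qed

lemma form_fund_simple:
  assumes i: "i \<in> {1..rank}" and j: "j \<in> {1..rank}"
  shows "form (fund i) (\<alpha> j) = (if i = j then form (\<alpha> j) (\<alpha> j) / 2 else 0)"
  using form_root[OF simple_root[OF j] fund_dual[OF i]] fund_coroot[OF i j]
  by (cases "i = j") (simp_all add: eq_divide_eq_numeral1 mult.commute)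

text \<open>\<open>\<theta> - b\<close> is a nonnegative combination of simple roots and
  \<open>f\<close> one of fundamental weights, and \<open>(fund i, \<alpha> j)\<close> is 0 or half
  the positive square length of \<open>\<alpha> j\<close>.\<close>

lemma form_dominant_root_le:
  assumes f: "f \<in> dominant_weights" and b: "b \<in> roots"
  shows "form f b \<le> form f \<theta>"
proof -
  obtain m :: "nat \<Rightarrow> nat" where m: "f = (\<Sum>i=1..rank. fscale (of_nat (m i)) (fund i))"
    using f by (auto simp: dominant_weights_def nonneg_comb_def)
  have fd: "f \<in> dual"
    unfolding m by (intro dual_closed fund_dual)
  obtain n where n: "\<theta> - b = (\<Sum>i=1..rank. fscale (of_nat (n i)) (\<alpha> i))"
    using theta_highest[OF b] by (auto simp: nonneg_comb_def)
  have "0 \<le> form (fund i) (\<alpha> j)" if "i \<in> {1..rank}" "j \<in> {1..rank}" for i j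
    using form_fund_simple[OF that] form_simple_positive[OF that(2)]
    by (auto simp: less_eq_complex_def)
  then have "0 \<le> (\<Sum>i=1..rank. of_nat (m i) * (\<Sum>j=1..rank. of_nat (n j) * form (fund i) (\<alpha> j)))"
    by (intro sum_nonneg mult_nonneg_nonneg complex_of_nat_nonneg)
  also have "\<dots> = form f (\<theta> - b)"
  proof -
    have "form f (\<theta> - b) = (\<Sum>i=1..rank. of_nat (m i) * form (fund i) (\<theta> - b))"
      using theta_dual roots_dual[OF b] fund_dual unfolding m
      by (intro form_sum_left) (auto intro: dual_closed)
    moreover have "form (fund i) (\<theta> - b) = (\<Sum>j=1..rank. of_nat (n j) * form (fund i) (\<alpha> j))"
      if "i \<in> {1..rank}" for i
      unfolding n using fund_dual[OF that] simple_dual by (rule form_sum_right)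
    ultimately show ?thesis
      by simp
  qed
  also have "\<dots> = form f \<theta> - form f b"
  proof -
    have "form f \<theta> = form f ((\<theta> - b) + b)"
      by simp
    also have "\<dots> = form f (\<theta> - b) + form f b"
      using theta_dual roots_dual[OF b] fd by (intro form_add_right) (auto intro: dual_closed)
    finally show ?thesis
      by simp
  qed
  finally show ?thesis
    by simp
qed

lemma reflection_length:
  assumes "a \<in> roots" "b \<in> roots" "form b b = 2"
  shows "form (reflection a b) (reflection a b) = 2"
  using assms form_reflection[of a b b] by (simp add: roots_dual)

text \<open>
  Descent on the height: a positive root \<open>b\<close> with \<open>(b, b) = 2\<close> has positive inner product with
  some simple root \<open>\<alpha> i\<close>, and reflecting in \<open>\<alpha> i\<close> changes the values \<open>(fund j, b)\<close> by the
  integer \<open>\<alpha> i (coroot b)\<close>.  The descent ends at a multiple of a simple root, which is simple.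
\<close>
lemma form_fund_long_root_int:
  assumes "b \<in> roots" "form b b = 2" "b = (\<Sum>i=1..rank. fscale (of_nat (g i)) (\<alpha> i))"
    and j: "j \<in> {1..rank}"
  shows "form (fund j) b \<in> \<int>"
  using assms(1-3)
proof (induction "\<Sum>i=1..rank. g i" arbitrary: b g rule: less_induct)
  case less
  note b = less.prems(1) and bb = less.prems(2) and b_sum = less.prems(3)
  have bd: "b \<in> dual"
    using b by (rule roots_dual)
  have form_b: "form f b = f (coroot b)" if "f \<in> dual" for f
    using form_root[OF b that] bb by simp
  have "\<forall>i\<in>{1..rank}. \<exists>z::int. \<alpha> i (coroot b) = of_int z"
    using root_coroot_int[OF b simple_root] by (metis Ints_cases)
  then obtain z :: "nat \<Rightarrow> int" where z: "\<And>i. i \<in> {1..rank} \<Longrightarrow> \<alpha> i (coroot b) = of_int (z i)"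
    using bchoice[of "{1..rank}" "\<lambda>i z. \<alpha> i (coroot b) = of_int z"] by blast
  \<comment> \<open>The summands add up to \<open>b (coroot b) = 2\<close>, so one of them is
    positive, which selects the simple root to reflect in.\<close>
  have "of_int (\<Sum>i=1..rank. int (g i) * z i) = (\<Sum>i=1..rank. of_nat (g i) * \<alpha> i (coroot b))"
    unfolding of_int_sum by (intro sum.cong) (auto simp: z)
  also have "\<dots> = b (coroot b)"
    using fun_cong[OF b_sum, of "coroot b"] by (simp only: sum_fscale_apply)
  also have "\<dots> = of_int 2"
    using root_coroot[OF b] by simp
  finally have "(\<Sum>i=1..rank. int (g i) * z i) = 2"
    by (simp only: of_int_eq_iff)
  then have "\<exists>i\<in>{1..rank}. 0 < int (g i) * z i"
    by (metis (no_types, lifting) not_less sum_nonpos zero_less_numeral)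
  then obtain i where i: "i \<in> {1..rank}" and gi: "0 < g i" and zi: "0 < z i"
    by (auto simp: zero_less_mult_iff)
  obtain y where y: "b (coroot (\<alpha> i)) = of_int y"
    using root_coroot_int[OF simple_root[OF i] b] by (auto elim: Ints_cases)
  obtain r :: real where r: "0 < r" "form (\<alpha> i) (\<alpha> i) = of_real r"
    using form_simple_positive[OF i] by blast
  \<comment> \<open>Both sides are \<open>2 (b, \<alpha> i)\<close>; since \<open>r > 0\<close>,
    \<open>y\<close> inherits the sign of \<open>z i\<close>.\<close>
  have yr: "of_int y * complex_of_real r = 2 * of_int (z i)"
    using form_root[OF simple_root[OF i] bd] form_commute[OF bd simple_dual[OF i]]
      form_b[OF simple_dual[OF i]] by (simp add: y r z[OF i])
  then have "complex_of_real (of_int y * r) = complex_of_real (2 * of_int (z i))"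
    by simp
  then have yr': "of_int y * r = 2 * of_int (z i)"
    by (simp only: of_real_eq_iff)
  then have "0 < y"
    using r(1) zi zero_less_mult_iff[of "of_int y" r] by simp
  define b' where "b' = reflection (\<alpha> i) b"
  have b'_eq: "b' = b - fscale (of_int y) (\<alpha> i)"
    by (simp add: b'_def reflection_def y)
  have b': "b' \<in> roots"
    unfolding b'_def by (rule reflection_root[OF simple_root[OF i] b])
  have b'b': "form b' b' = 2"
    unfolding b'_def by (rule reflection_length[OF simple_root[OF i] b bb])
  \<comment> \<open>The length \<open>r\<close> cancels:
    \<open>y (fund i, \<alpha> i) = y r / 2 = z i\<close>.\<close>
  have form_fund_i: "of_int y * form (fund j) (\<alpha> i) = (if j = i then of_int (z i) else 0)"
    using form_fund_simple[OF j i] yr by (simp add: r)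
  from root_sign[OF b'] show ?case
  proof
    assume "nonneg_comb \<alpha> b'"
    then obtain g' :: "nat \<Rightarrow> nat" where g': "b' = (\<Sum>i=1..rank. fscale (of_nat (g' i)) (\<alpha> i))"
      by (auto simp: nonneg_comb_def)
    have coeff: "int (g' k) = (if k = i then int (g k) - y else int (g k))"
      if k: "k \<in> {1..rank}" for k
    proof -
      have "(of_nat (g' k) :: complex) = (if k = i then of_nat (g k) - of_int y else of_nat (g k))"
        using simple_sub_coeff[of "\<lambda>i. of_nat (g i)" "of_int y" i "\<lambda>i. of_nat (g' i)" k] i k
          b'_eq g' b_sum by metis
      then have "(of_int (int (g' k)) :: complex)
          = of_int (if k = i then int (g k) - y else int (g k))"
        by (simp split: if_splits)
      then show ?thesis
        by (simp only: of_int_eq_iff)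
    qed
    have "(\<Sum>k=1..rank. g' k) < (\<Sum>k=1..rank. g k)"
    proof (rule sum_strict_mono_ex1)
      show "\<forall>k\<in>{1..rank}. g' k \<le> g k"
      proof
        fix k assume "k \<in> {1..rank}"
        then show "g' k \<le> g k"
          using coeff[of k] \<open>0 < y\<close> by (cases "k = i") auto
      qed
      show "\<exists>k\<in>{1..rank}. g' k < g k"
        using coeff[OF i] \<open>0 < y\<close> i by (intro bexI[of _ i]) auto
    qed simp
    then have IH: "form (fund j) b' \<in> \<int>"
      using less.hyps b' b'b' g' by blast
    have "b = b' + fscale (of_int y) (\<alpha> i)"
      by (simp add: b'_eq)
    then have "form (fund j) b = form (fund j) b' + of_int y * form (fund j) (\<alpha> i)"
      using fund_dual[OF j] roots_dual[OF b'] simple_dual[OF i]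
      by (simp add: form_add_right form_scale_right dual_fscale)
    then show ?thesis
      using IH unfolding form_fund_i by auto
  next
    assume "nonneg_comb \<alpha> (- b')"
    then obtain g' :: "nat \<Rightarrow> nat" where g': "- b' = (\<Sum>i=1..rank. fscale (of_nat (g' i)) (\<alpha> i))"
      by (auto simp: nonneg_comb_def)
    have b'_sum: "b' = (\<Sum>i=1..rank. fscale (- of_nat (g' i)) (\<alpha> i))"
    proof
      fix x
      have "- b' x = (\<Sum>i=1..rank. of_nat (g' i) * \<alpha> i x)"
        using fun_cong[OF g', of x] by (simp only: sum_fscale_apply uminus_apply)
      then have "b' x = - (\<Sum>i=1..rank. of_nat (g' i) * \<alpha> i x)"
        by (metis minus_minus)
      then show "b' x = (\<Sum>i=1..rank. fscale (- of_nat (g' i)) (\<alpha> i)) x"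
        by (simp add: sum_fscale_apply sum_negf)
    qed
    \<comment> \<open>The reflection alters only the coefficient at \<open>i\<close>, so for
      \<open>k \<noteq> i\<close> the coefficient \<open>g k\<close> is both nonnegative and
      nonpositive.\<close>
    have "g k = 0" if k: "k \<in> {1..rank}" "k \<noteq> i" for k
    proof -
      have "- (of_nat (g' k) :: complex) = of_nat (g k)"
        using simple_sub_coeff[of "\<lambda>i. of_nat (g i)" "of_int y" i "\<lambda>i. - of_nat (g' i)" k] i k
          b'_eq b'_sum b_sum by metis
      then have "(of_nat (g k + g' k) :: complex) = 0"
        by (metis add.left_inverse add.commute of_nat_add)
      then show ?thesis
        by (simp only: of_nat_eq_0_iff)
    qed
    then have "b x = of_nat (g i) * \<alpha> i x" for x
    proof -
      assume zero: "\<And>k. \<lbrakk>k \<in> {1..rank}; k \<noteq> i\<rbrakk> \<Longrightarrow> g k = 0"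
      have "b x = (\<Sum>k=1..rank. of_nat (g k) * \<alpha> k x)"
        using fun_cong[OF b_sum, of x] by (simp only: sum_fscale_apply)
      also have "\<dots> = (\<Sum>k=1..rank. if k = i then of_nat (g k) * \<alpha> k x else 0)"
        by (rule sum.cong) (auto simp: zero)
      finally show ?thesis
        using i by simp
    qed
    then have b_multiple: "b = fscale (of_nat (g i)) (\<alpha> i)"
      by (simp add: fun_eq_iff)
    have "of_nat (g i) * \<alpha> i (coroot b) = b (coroot b)"
      using fun_cong[OF b_multiple, of "coroot b"] by simp
    then have "(of_int (int (g i) * z i) :: complex) = of_int 2"
      using root_coroot[OF b] z[OF i] by simp
    \<comment> \<open>Thus \<open>b\<close> is \<open>g i\<close> times \<open>\<alpha> i\<close>
      with \<open>g i\<close> a divisor of 2; the value 2 is ruled out by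
      \<open>double_root_not_root\<close>.\<close>
    then have gz: "int (g i) * z i = 2"
      by (simp only: of_int_eq_iff)
    then have "g i dvd 2"
      by (metis dvd_triv_left int_dvd_int_iff of_nat_numeral)
    then have "g i \<le> 2"
      by (rule dvd_imp_le) simp
    moreover have "g i \<noteq> 2"
      using b b_multiple double_root_not_root[OF simple_root[OF i]] by auto
    ultimately have "g i = 1"
      using gi by simp
    then have "b = \<alpha> i"
      using b_multiple by (simp add: fun_eq_iff)
    then have "form (fund j) b = (if j = i then 1 else 0)"
      using form_fund_simple[OF j i] bb by simp
    then show ?thesis
      by simp
  qed
qed

lemma form_fund_theta_int: "j \<in> {1..rank} \<Longrightarrow> form (fund j) \<theta> \<in> \<int>"
proof -
  assume j: "j \<in> {1..rank}"
  obtain c :: "nat \<Rightarrow> nat" where "\<theta> = (\<Sum>i=1..rank. fscale (of_nat (c i)) (\<alpha> i))"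
    using theta_coeffs by metis
  then show ?thesis
    by (rule form_fund_long_root_int[OF theta_root normalized _ j])
qed

section \<open>The weight lattice and the Weyl orbit of the highest root\<close>

lemma weight_lattice_dual: "f \<in> weight_lattice \<Longrightarrow> f \<in> dual"
  unfolding weight_lattice_def by (auto intro!: dual_closed fund_dual)

lemma form_weight_lattice_theta_int: "f \<in> weight_lattice \<Longrightarrow> form f \<theta> \<in> \<int>"
proof -
  assume "f \<in> weight_lattice"
  then obtain n :: "nat \<Rightarrow> int" where n: "f = (\<Sum>i=1..rank. fscale (of_int (n i)) (fund i))"
    by (auto simp: weight_lattice_def)
  have "form f \<theta> = (\<Sum>i=1..rank. of_int (n i) * form (fund i) \<theta>)"
    unfolding n using theta_dual fund_dual by (rule form_sum_left)
  also have "\<dots> \<in> \<int>"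
    using form_fund_theta_int by (intro Ints_sum Ints_mult) auto
  finally show ?thesis .
qed

lemma dominant_weight_lattice: "f \<in> dominant_weights \<Longrightarrow> f \<in> weight_lattice"
proof -
  assume "f \<in> dominant_weights"
  then obtain m :: "nat \<Rightarrow> nat" where m: "f = (\<Sum>i=1..rank. fscale (of_nat (m i)) (fund i))"
    by (auto simp: dominant_weights_def nonneg_comb_def)
  then have "f = (\<Sum>i=1..rank. fscale (of_int (int (m i))) (fund i))"
    by simp
  then show ?thesis
    unfolding weight_lattice_def by (intro CollectI exI[of _ "\<lambda>i. int (m i)"])
qed

lemma weight_latticeI:
  assumes f: "f \<in> dual" and int: "\<And>i. i \<in> {1..rank} \<Longrightarrow> f (coroot (\<alpha> i)) \<in> \<int>"
  shows "f \<in> weight_lattice"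
proof -
  have "\<forall>i\<in>{1..rank}. \<exists>z::int. f (coroot (\<alpha> i)) = of_int z"
    using int by (metis Ints_cases)
  then obtain z :: "nat \<Rightarrow> int" where z: "\<And>i. i \<in> {1..rank} \<Longrightarrow> f (coroot (\<alpha> i)) = of_int (z i)"
    using bchoice[of "{1..rank}" "\<lambda>i z. f (coroot (\<alpha> i)) = of_int z"] by blast
  have "f = (\<Sum>i=1..rank. fscale (f (coroot (\<alpha> i))) (fund i))"
    using f by (rule fund_expansion)
  also have "\<dots> = (\<Sum>i=1..rank. fscale (of_int (z i)) (fund i))"
    by (intro sum.cong) (auto simp: z)
  finally show ?thesis
    unfolding weight_lattice_def by blast
qed

lemma weight_lattice_add: "\<lbrakk>f \<in> weight_lattice; g \<in> weight_lattice\<rbrakk> \<Longrightarrow> f + g \<in> weight_lattice"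
proof -
  assume "f \<in> weight_lattice" "g \<in> weight_lattice"
  then obtain n n' :: "nat \<Rightarrow> int" where "f = (\<Sum>i=1..rank. fscale (of_int (n i)) (fund i))"
      "g = (\<Sum>i=1..rank. fscale (of_int (n' i)) (fund i))"
    by (auto simp: weight_lattice_def)
  then have "f + g = (\<Sum>i=1..rank. fscale (of_int (n i + n' i)) (fund i))"
    by (simp add: fun_eq_iff sum_fscale_apply sum.distrib algebra_simps)
  then show ?thesis
    unfolding weight_lattice_def by (intro CollectI exI[of _ "\<lambda>i. n i + n' i"])
qed

lemma rho_dominant: "rho \<in> dominant_weights"
  unfolding dominant_weights_def nonneg_comb_def rho_def
  by (intro CollectI exI[of _ "\<lambda>_. 1"]) (simp add: fun_eq_iff sum_fscale_apply fscale_def)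

lemma weyl_dual: "\<lbrakk>w \<in> weyl_group; f \<in> dual\<rbrakk> \<Longrightarrow> w f \<in> dual"
  by (induction rule: weyl_group.induct) (auto intro: reflection_dual)

lemma pairing_weyl_theta:
  assumes w: "w \<in> weyl_group"
  shows "pairing form f (w \<theta>) = form f (w \<theta>)"
  using form_weyl[OF w theta_dual theta_dual] by (simp add: pairing_def normalized)

text \<open>Invariance moves the outermost reflection of \<open>w\<close> onto \<open>f\<close>, so
  induction on \<open>w\<close> plays the part of its inverse. The reflection-stable set
  \<open>X\<close> later ensures that \<open>f'\<close> is again a weight of
  \<open>V\<close>.\<close>

lemma form_weyl_transfer:
  assumes X: "X \<subseteq> dual" "\<And>a f. \<lbrakk>a \<in> roots; f \<in> X\<rbrakk> \<Longrightarrow> reflection a f \<in> X"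
    and w: "w \<in> weyl_group"
  shows "f \<in> X \<Longrightarrow> \<exists>f'\<in>X. form f (w \<theta>) = form f' \<theta>"
  using w
proof (induction arbitrary: f rule: weyl_group.induct)
  case one
  then show ?case
    by auto
next
  case (refl a w)
  have "form f ((reflection a \<circ> w) \<theta>)
      = form (reflection a (reflection a f)) (reflection a (w \<theta>))"
    by (simp add: reflection_reflection[OF refl(1)])
  also have "\<dots> = form (reflection a f) (w \<theta>)"
    using refl X weyl_dual[OF refl(2) theta_dual] by (intro form_reflection) auto
  finally show ?case
    using refl.IH X(2)[OF refl(1) refl.prems] by auto
qed

end

subsection \<open>Highest weight modules\<close>

sublocale simple_lie_algebra_module \<subseteq> cartan_module scale bracket H scaleV act
  by unfold_locales

context simple_lie_algebra_module
begin

lemma weight_space_eq_wspace: "weight_space b = wspace b"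
  by (simp add: weight_space_def wspace_def)

lemma weights_eq_wts: "weights = wts"
  by (simp add: weights_def wts_def weight_space_eq_wspace)

text \<open>The weight is carried along as an argument of its own, because a vector \<open>w\<close>
  that has become zero no longer determines it.\<close>

inductive descends :: "'v \<Rightarrow> ('g \<Rightarrow> complex) \<Rightarrow> 'v \<Rightarrow> ('g \<Rightarrow> complex) \<Rightarrow> bool"
  for v :: 'v and l :: "'g \<Rightarrow> complex" where
  start: "descends v l v l"
| lower: "\<lbrakk>descends v l w b; a \<in> positive_roots \<alpha>; y \<in> root_space (- a)\<rbrakk>
    \<Longrightarrow> descends v l (act y w) (b - a)"

lemma descends_weight:
  assumes "descends v l w b" "v \<in> wspace l" "l \<in> dual"
  shows "w \<in> wspace b \<and> b \<in> dual \<and> nonneg_comb \<alpha> (l - b)"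
  using assms
proof (induction rule: descends.induct)
  case start
  have "l - l = 0"
    by (rule diff_self)
  then show ?case
    using start nonneg_comb_0 by metis
next
  case (lower w b a y)
  have "a \<in> dual" "nonneg_comb \<alpha> a"
    using lower.hyps(2) by (auto simp: positive_roots_def roots_dual)
  then have "nonneg_comb \<alpha> ((l - b) + a)"
    using lower by (intro nonneg_comb_add) blast+
  moreover have "l - (b - a) = (l - b) + a"
    by (simp add: fun_eq_iff)
  moreover have "act y w \<in> wspace (b - a)"
    using act_root_space[OF lower.hyps(3), of w b] lower by (simp only: diff_conv_add_uminus)
  ultimately show ?case
    using lower \<open>a \<in> dual\<close> by (simp only: dual_diff)
qed

text \<open>
  The span of the vectors \<open>y\<^sub>1 \<cdots> y\<^sub>n v\<close> with all \<open>y\<^sub>i\<close> in negative root spaces is a submodule: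
  \<open>x y w = [x, y] w + y (x w)\<close>, and both \<open>[x, y] w\<close> and \<open>x w\<close> are covered by the induction
  hypothesis for the shorter word \<open>w\<close>.
\<close>
lemma act_descends:
  assumes v: "v \<in> wspace l" "\<And>a x. \<lbrakk>a \<in> positive_roots \<alpha>; x \<in> root_space a\<rbrakk> \<Longrightarrow> act x v = 0"
    and w: "descends v l w b"
  shows "act x w \<in> V.span {w. \<exists>b. descends v l w b}"
  using w
proof (induction arbitrary: x rule: descends.induct)
  case start
  have "x \<in> span (H \<union> (\<Union>a\<in>roots. root_space a))"
    by (simp add: span_H_root_spaces)
  then show ?case
  proof (induction rule: span_induct_alt)
    case (step c x y)
    have "act x v \<in> V.span {w. \<exists>b. descends v l w b}"
    proof (cases "x \<in> H")
      case True
      then show ?thesis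
        unfolding act_wspace[OF v(1) True]
        by (intro V.span_scale V.span_base) (blast intro: descends.start)
    next
      case False
      then obtain a where a: "a \<in> roots" "x \<in> root_space a"
        using step(1) by blast
      show ?thesis
      proof (cases "a \<in> positive_roots \<alpha>")
        case True
        then show ?thesis
          using v(2) a(2) by (simp add: V.span_zero)
      next
        case False
        then have "- a \<in> positive_roots \<alpha>"
          using a(1) root_sign[OF a(1)] root_minus by (auto simp: positive_roots_def)
        then have "descends v l (act x v) (l - - a)"
          using a(2) by (intro descends.lower descends.start) auto
        then show ?thesis
          by (intro V.span_base) blast
      qed
    qed
    then show ?case
      using step(2) by (simp add: act_left.add act_left.scale V.span_add V.span_scale)
  qed (simp add: act_left.zero V.span_zero)
next
  case (lower w b a y)
  let ?T = "{w. \<exists>b. descends v l w b}"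
  have "act y ` ?T \<subseteq> V.span ?T"
    using descends.lower[OF _ lower.hyps(2,3)] by (blast intro: V.span_base)
  then have "act y (act x w) \<in> V.span ?T"
    using lower.IH V.linear_image_span_subset[OF act.linear_axioms] by blast
  moreover have "act x (act y w) = act (bracket x y) w + act y (act x w)"
    by (simp add: act_bracket)
  ultimately show ?case
    using lower.IH[of "bracket x y"] by (simp add: V.span_add)
qed

text \<open>The descending vectors span a nonzero submodule, hence all of \<open>V\<close>. So every
  weight of \<open>V\<close> is the recorded weight of such a vector and lies below
  \<open>l\<close>, and a finite basis among them leaves finitely many weights.\<close>

lemma highest_weight_module:
  assumes irr: "finite_dim_irreducible" and hw: "has_highest_weight l"
  shows "finite wts" and "l \<in> wts" and "b \<in> wts \<Longrightarrow> nonneg_comb \<alpha> (l - b)"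
proof -
  obtain v where l: "l \<in> dual" and v: "v \<in> wspace l" "v \<noteq> 0"
    and ann: "\<And>a x. \<lbrakk>a \<in> positive_roots \<alpha>; x \<in> root_space a\<rbrakk> \<Longrightarrow> act x v = 0"
    using hw by (auto simp: has_highest_weight_def weight_space_eq_wspace)
  show "l \<in> wts"
    using l v by (rule wtsI)
  define T where "T = {w. \<exists>b. descends v l w b}"
  have "act x w \<in> V.span T" if "w \<in> T" for x w
    using that act_descends[OF v(1)] ann unfolding T_def by blast
  then have "act x u \<in> V.span T" if "u \<in> V.span T" for x u
    using V.linear_image_span_subset[OF act.linear_axioms _ that, of x] by blast
  then have "V.span T = {0} \<or> V.span T = UNIV"
    using irr V.subspace_span unfolding finite_dim_irreducible_def by blast
  moreover have "v \<in> V.span T"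
    unfolding T_def by (intro V.span_base) (blast intro: descends.start)
  ultimately have T: "V.span T = UNIV"
    using v(2) by blast
  obtain wt where wt: "\<And>t. t \<in> T \<Longrightarrow> descends v l t (wt t)"
    using bchoice[of T "descends v l"] by (auto simp: T_def)
  have wt': "t \<in> wspace (wt t)" "wt t \<in> dual" "nonneg_comb \<alpha> (l - wt t)" if "t \<in> T" for t
    using descends_weight[OF wt[OF that] v(1) l] by auto
  obtain C where "finite C" "V.span C = UNIV"
    using irr by (auto simp: finite_dim_irreducible_def)
  then obtain B where B: "finite B" "V.span B = UNIV" "B \<subseteq> T"
    using weight_basis_exists[OF _ _ T] by metis
  show "finite wts"
    by (rule finite_wts[OF B(1,2), of wt]) (use B(3) wt' in auto)
  show "nonneg_comb \<alpha> (l - b)" if b: "b \<in> wts"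
  proof -
    obtain u where u: "u \<in> wspace b" "u \<noteq> 0"
      using b by (rule wtsE)
    have "\<exists>t\<in>T. t \<noteq> 0 \<and> wt t = b"
      by (rule weight_of_spanning_vector[OF u]) (use b wt' T in \<open>auto simp: wts_def\<close>)
    then show ?thesis
      using wt'(3) by blast
  qed
qed

text \<open>Dominance of \<open>\<theta>\<close> enters as \<open>(\<alpha> i, \<theta>) = \<alpha>
  i (coroot \<theta>) \<ge> 0\<close>.\<close>

lemma form_weight_theta_le:
  assumes "l \<in> dual" "b \<in> dual" and nonneg: "nonneg_comb \<alpha> (l - b)"
  shows "form b \<theta> \<le> form l \<theta>"
proof -
  obtain n :: "nat \<Rightarrow> nat" where n: "l - b = (\<Sum>i=1..rank. fscale (of_nat (n i)) (\<alpha> i))"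
    using nonneg by (auto simp: nonneg_comb_def)
  have pos: "0 \<le> form (\<alpha> i) \<theta>" if i: "i \<in> {1..rank}" for i
  proof -
    obtain k :: nat where "\<alpha> i (coroot \<theta>) = of_nat k"
      using simple_coroot_theta_nonneg[OF i] .
    then show ?thesis
      using form_root_theta[OF simple_dual[OF i]] by (simp add: complex_of_nat_nonneg)
  qed
  have "0 \<le> (\<Sum>i=1..rank. of_nat (n i) * form (\<alpha> i) \<theta>)"
    using pos by (intro sum_nonneg mult_nonneg_nonneg complex_of_nat_nonneg)
  also have "\<dots> = form (l - b) \<theta>"
    unfolding n using theta_dual simple_dual by (intro form_sum_left[symmetric])
  finally have "0 \<le> form (l - b) \<theta>" .
  moreover have "form l \<theta> = form (l - b) \<theta> + form b \<theta>"
    using form_add_left[of "l - b" b \<theta>] assms theta_dual by (simp add: dual_diff)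
  ultimately show ?thesis
    by simp
qed

text \<open>The lower bound is the upper bound for the weight \<open>reflection \<theta> b'\<close>,
  since \<open>(reflection \<theta> b', \<theta>) = - (b', \<theta>)\<close>.\<close>

lemma weight_weyl_theta_bounds:
  assumes irr: "finite_dim_irreducible" and hw: "has_highest_weight l"
    and b: "b \<in> wts" and w: "w \<in> weyl_group"
  shows "form b (w \<theta>) \<le> form l \<theta>" and "- form l \<theta> \<le> form b (w \<theta>)"
    and "form b (w \<theta>) \<in> \<int>"
proof -
  note hwm = highest_weight_module[OF irr hw]
  have wts_dual: "wts \<subseteq> dual"
    by (auto simp: wts_def)
  obtain b' where b': "b' \<in> wts" and eq: "form b (w \<theta>) = form b' \<theta>"
    using form_weyl_transfer[OF wts_dual weight_reflection(2)[OF hwm(1)] w b] by blast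
  have le: "form c \<theta> \<le> form l \<theta>" if "c \<in> wts" for c
    using that hwm(2,3) wts_dual by (intro form_weight_theta_le) auto
  show "form b (w \<theta>) \<le> form l \<theta>"
    using le[OF b'] eq by simp
  have b'd: "b' \<in> dual"
    using b' wts_dual by blast
  have "form (reflection \<theta> b') \<theta> = - form b' \<theta>"
    using form_root_theta[OF b'd] form_root_theta[OF reflection_dual[OF theta_root b'd]]
      root_coroot[OF theta_root] by (simp add: reflection_def)
  then show "- form l \<theta> \<le> form b (w \<theta>)"
    using le[OF weight_reflection(2)[OF hwm(1) theta_root b']] eq minus_le_iff by metis
  show "form b (w \<theta>) \<in> \<int>"
    using eq form_root_theta[OF b'd] weight_reflection(1)[OF hwm(1) theta_root b'] by simp
qed

lemma weights_level_set:
  assumes irr: "finite_dim_irreducible" and hw: "has_highest_weight l"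
    and l: "l \<in> dominant_weights" and m: "m \<in> dominant_weights"
  shows "pairing form (l + m) \<theta> \<le> of_int k
    \<longleftrightarrow> {b + m + rho | b. b \<in> weights} \<subseteq> level_set k"
proof -
  note hwm = highest_weight_module[OF irr hw]
  note lattice = dominant_weight_lattice[OF l] dominant_weight_lattice[OF m]
    dominant_weight_lattice[OF rho_dominant]
  note duals = lattice[THEN weight_lattice_dual]
  obtain zl zm zr :: int where z: "form l \<theta> = of_int zl" "form m \<theta> = of_int zm"
      "form rho \<theta> = of_int zr"
    using lattice[THEN form_weight_lattice_theta_int] by (auto elim!: Ints_cases)
  have theta_pairing: "pairing form f \<theta> = form f \<theta>" for f
    by (simp add: pairing_def normalized)
  have coxeter: "dual_coxeter = of_int (1 + zr)"
    by (simp add: dual_coxeter_def theta_pairing z)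
  have lm: "form (l + m) \<theta> = of_int (zl + zm)"
    using duals theta_dual by (simp add: form_add_left z)
  \<comment> \<open>On integers the order of the complex numbers is that of \<open>int\<close>, so
    the final comparisons become integer ones.\<close>
  have of_int_less: "of_int i < (of_int j :: complex) \<longleftrightarrow> i < j"
    and of_int_le: "of_int i \<le> (of_int j :: complex) \<longleftrightarrow> i \<le> j" for i j
    by (simp_all add: less_complex_def less_eq_complex_def)
  show ?thesis
  proof
    assume "pairing form (l + m) \<theta> \<le> of_int k"
    then have level: "zl + zm \<le> k"
      unfolding theta_pairing lm of_int_le .
    show "{b + m + rho | b. b \<in> weights} \<subseteq> level_set k"
    proof clarify
      fix b assume "b \<in> weights"
      then have b: "b \<in> wts"
        by (simp add: weights_eq_wts)
      then have bd: "b \<in> dual"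
        by (simp add: wts_def)
      have "b \<in> weight_lattice"
        using weight_reflection(1)[OF hwm(1) simple_root b] bd by (intro weight_latticeI)
      then have "b + m + rho \<in> weight_lattice"
        using lattice by (intro weight_lattice_add)
      moreover have "- (of_int k + dual_coxeter) < pairing form (b + m + rho) (w \<theta>)
          \<and> pairing form (b + m + rho) (w \<theta>) < of_int k + dual_coxeter"
        if w: "w \<in> weyl_group" for w
      proof -
        have wt: "w \<theta> \<in> roots" "- w \<theta> \<in> roots"
          using weyl_root[OF w theta_root] root_minus by auto
        note wd = roots_dual[OF wt(1)]
        have neg: "form f (- w \<theta>) = - form f (w \<theta>)" if "f \<in> dual" for f
        proof -
          have "- w \<theta> = fscale (- 1) (w \<theta>)"
            by (simp add: fun_eq_iff)
          then show ?thesis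
            using form_scale_right[OF wd that] by simp
        qed
        have bound: "form f (w \<theta>) \<le> form f \<theta>" "- form f \<theta> \<le> form f (w \<theta>)"
          if "f \<in> dominant_weights" "f \<in> dual" for f
          using form_dominant_root_le[OF that(1) wt(1)] form_dominant_root_le[OF that(1) wt(2)]
            neg[OF that(2)] minus_le_iff by metis+
        note bb = weight_weyl_theta_bounds[OF irr hw b w]
        let ?s = "form (b + m + rho) (w \<theta>)"
        have s: "?s = form b (w \<theta>) + form m (w \<theta>) + form rho (w \<theta>)"
          using bd duals wd by (simp add: form_add_left dual_add)
        have "?s \<le> form l \<theta> + form m \<theta> + form rho \<theta>"
          unfolding s using bb(1) bound(1)[OF m duals(2)] bound(1)[OF rho_dominant duals(3)]
          by (intro add_mono)
        also have "\<dots> = of_int (zl + zm + zr)"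
          by (simp add: z)
        \<comment> \<open>\<open>dual_coxeter\<close> equals \<open>1 + zr\<close>; its summand 1
          makes the inequality strict.\<close>
        also have "\<dots> < of_int k + dual_coxeter"
          using level unfolding coxeter of_int_add[symmetric] of_int_less by simp
        finally have upper: "?s < of_int k + dual_coxeter" .
        have "- (of_int k + dual_coxeter) < of_int (- zl + - zm + - zr)"
          using level unfolding coxeter of_int_add[symmetric] of_int_minus[symmetric] of_int_less
          by simp
        also have "\<dots> = - form l \<theta> + - form m \<theta> + - form rho \<theta>"
          by (simp add: z)
        also have "\<dots> \<le> ?s"
          unfolding s using bb(2) bound(2)[OF m duals(2)] bound(2)[OF rho_dominant duals(3)]
          by (intro add_mono)
        finally show ?thesis
          using upper by (simp add: pairing_weyl_theta[OF w])
      qed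
      ultimately show "b + m + rho \<in> level_set k"
        by (simp add: level_set_def)
    qed
  next
    assume sub: "{b + m + rho | b. b \<in> weights} \<subseteq> level_set k"
    have "l + m + rho \<in> level_set k"
      using sub hwm(2) weights_eq_wts by blast
    then have "pairing form (l + m + rho) (id \<theta>) < of_int k + dual_coxeter"
      unfolding level_set_def using weyl_group.one by blast
    moreover have "pairing form (l + m + rho) (id \<theta>) = of_int (zl + zm + zr)"
      using duals theta_dual by (simp add: theta_pairing form_add_left dual_add z)
    ultimately have "zl + zm + zr < k + (1 + zr)"
      unfolding coxeter by (simp only: of_int_add[symmetric] of_int_less)
    then show "pairing form (l + m) \<theta> \<le> of_int k"
      unfolding theta_pairing lm of_int_le by simp
  qed
qed

end


theorem theorem6p2:
  fixes scale :: "complex \<Rightarrow> 'g::ab_group_add \<Rightarrow> 'g"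
    and bracket :: "'g \<Rightarrow> 'g \<Rightarrow> 'g"
    and H :: "'g set"
    and \<alpha> :: "nat \<Rightarrow> 'g \<Rightarrow> complex"
    and \<theta> :: "'g \<Rightarrow> complex"
    and form :: "('g \<Rightarrow> complex) \<Rightarrow> ('g \<Rightarrow> complex) \<Rightarrow> complex"
    and fund :: "nat \<Rightarrow> 'g \<Rightarrow> complex"
    and scaleV :: "complex \<Rightarrow> 'v::ab_group_add \<Rightarrow> 'v"
    and act :: "'g \<Rightarrow> 'v \<Rightarrow> 'v"
    and l m :: "'g \<Rightarrow> complex"
    and k :: int
  assumes "simple_lie_algebra_module scale bracket H \<alpha> \<theta> form fund scaleV act"
    and "l \<in> simple_lie_algebra_data.dominant_weights scale H fund"
    and "m \<in> simple_lie_algebra_data.dominant_weights scale H fund"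
    and "lie_module.finite_dim_irreducible scaleV act"
    and "simple_lie_algebra_module.has_highest_weight scale bracket H \<alpha> scaleV act l"
    and "k \<ge> 1"
  shows "pairing form (l + m) \<theta> \<le> of_int k \<longleftrightarrow>
    {b + m + simple_lie_algebra_data.rho scale H fund | b.
        b \<in> simple_lie_algebra_module.weights scale H scaleV act}
      \<subseteq> simple_lie_algebra_data.level_set scale bracket H \<theta> form fund k"
  using simple_lie_algebra_module.weights_level_set[OF assms(1,4,5,2,3)] .

end
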